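(* (i) Let $n=2$ and $p<r_b$, where $r_b$ is the threshold for $n=2$ below which the symmetric buyer-optimal signal distribution $G_b$ puts positive mass on signal $0$. Then there exist asymmetric information structures $(G_1,G_2)$, $G_1\neq G_2$, which strictly improve upon the optimal symmetric signal distribution $G_b$ in terms of the buyers' surplus: $V_1(G_1,G_2)>V_1(G_b,G_b)$. (ii) For $n\to\infty$, there exist asymmetric information structures which strictly improve, in terms of the buyers' surplus $V_1$, upon the limiting optimal symmetric signal distribution, namely the degenerate distribution $\delta_p$ which assigns probability one to the signal $p$ (when every buyer's signal distribution is $\delta_p$, the buyers' surplus is $V_1(\delta_p,\dots,\delta_p)=0$).
   Context: There are $n$ buyers, $N=\{1,\dots,n\}$, and one object. Each buyer's valuation is independently Bernoulli on $\{0,1\}$ with mean $p\in(0,1)$. An information structure is a profile $\mathbf G=(G_1,\dots,G_n)$ of CDFs on $[0,1]$, each with mean $p$; buyer $i$ receives a signal $x_i\sim G_i$, independently across buyers. It is symmetric if all $G_i$ coincide and asymmetric otherwise. Ironed virtual value. For a CDF $G$ on $[0,1]$ let $a=\inf\{x\in[0,1]: G(x)>0\}$; $\Psi(x|G)=0$ for $x\in[0,a)$ and $\Psi(x|G)=a-x(1-G(x))$ for $x\in[a,1]$. Let $\Theta=\{(\beta_0,\beta_1)\in\mathbb R^2:\beta_0+\beta_1G(x)\le\Psi(x|G)\ \forall x\in[0,1]\}$ and $\Phi(x|G)=\sup\{\beta_0+\beta_1G(x):(\beta_0,\beta_1)\in\Theta\}$. A number $w$ is a sub-gradient of $\Phi(\cdot|G)$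 at $x$ if $\Phi(z|G)-\Phi(x|G)\ge w\,(G(z)-G(x))$ for all $z\in[0,1]$. The ironed virtual value $\hat\varphi(x|G)$ is the infimum of the set of sub-gradients at $x$. Allocation (optimal auction, ties broken in favor of surplus). For a signal profile $x$ let $M(x|\mathbf G)=\{i\in N:\hat\varphi(x_i|G_i)\ge\max_j\{\hat\varphi(x_j|G_j),0\}\}$ and $M'(x|\mathbf G)=\{i\in M(x|\mathbf G): x_i\ge x_j\ \forall j\in M(x|\mathbf G)\}$. Put $q_i(x|\mathbf G)=1/|M'(x|\mathbf G)|$ if $i\in M'(x|\mathbf G)$ and $0$ otherwise. Buyers' surplus: $$V_1(\mathbf G)=\int_{[0,1]^n}\sum_{i=1}^n\big(x_i-\hat\varphi(x_i|G_i)\big)q_i(x|\mathbf G)\prod_{i=1}^n\mathrm dG_i(x_i)$$ (terms with $q_i=0$ are $0$). The symmetric buyer-optimal signal distribution $G_b$ (depending on $n$ and $p$) is the unique maximizer of $V_1(G,\dots,G)$ among CDFs $G$ on $[0,1]$ with mean $p$. For $n=2$, $G_b(0)>0$ if $p<r_b$ and $G_b(0)=0$ if $p\ge r_b$; explicitly $r_b=(1-\theta)(1-\log(1-\theta))$, where $\theta\in(0,1)$ solves $2\theta+\log(1-\theta)=0$. As $n\to\infty$ with $p$ fixed, $G_b$ converges to the degenerate distribution $\delta_p$. *)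

theory Defs
  imports "HOL-Analysis.Analysis"
begin

text \<open>Signal distributions are represented by their CDFs, as functions on all of \<open>real\<close>;
  integration against \<open>dG\<close> is integration against \<open>interval_measure G\<close>.\<close>

definition unit_cdf :: "(real \<Rightarrow> real) \<Rightarrow> bool" where
  "unit_cdf G \<longleftrightarrow> mono G \<and> (\<forall>x. continuous (at_right x) G) \<and>
     (\<forall>x<0. G x = 0) \<and> (\<forall>x\<ge>1. G x = 1)"

definition signal_cdf :: "real \<Rightarrow> (real \<Rightarrow> real) \<Rightarrow> bool" where
  "signal_cdf p G \<longleftrightarrow> unit_cdf G \<and> (LINT x|interval_measure G. x) = p"

definition degenerate_cdf :: "real \<Rightarrow> real \<Rightarrow> real" where
  "degenerate_cdf p x = (if x < p then 0 else 1)"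

definition information_structure :: "nat \<Rightarrow> real \<Rightarrow> (nat \<Rightarrow> real \<Rightarrow> real) \<Rightarrow> bool" where
  "information_structure n p G \<longleftrightarrow> (\<forall>i\<in>{1..n}. signal_cdf p (G i))"

definition asymmetric :: "nat \<Rightarrow> (nat \<Rightarrow> real \<Rightarrow> real) \<Rightarrow> bool" where
  "asymmetric n G \<longleftrightarrow> (\<exists>i\<in>{1..n}. \<exists>j\<in>{1..n}. G i \<noteq> G j)"

definition lowest_signal :: "(real \<Rightarrow> real) \<Rightarrow> real" where
  "lowest_signal G = Inf {x \<in> {0..1}. G x > 0}"

definition Psi :: "(real \<Rightarrow> real) \<Rightarrow> real \<Rightarrow> real" where
  "Psi G x = (if x < lowest_signal G then 0 else lowest_signal G - x * (1 - G x))"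

definition Theta :: "(real \<Rightarrow> real) \<Rightarrow> (real \<times> real) set" where
  "Theta G = {(\<beta>\<^sub>0, \<beta>\<^sub>1). \<forall>x\<in>{0..1}. \<beta>\<^sub>0 + \<beta>\<^sub>1 * G x \<le> Psi G x}"

definition Phi :: "(real \<Rightarrow> real) \<Rightarrow> real \<Rightarrow> real" where
  "Phi G x = (SUP (\<beta>\<^sub>0, \<beta>\<^sub>1)\<in>Theta G. \<beta>\<^sub>0 + \<beta>\<^sub>1 * G x)"

definition subgradients :: "(real \<Rightarrow> real) \<Rightarrow> real \<Rightarrow> real set" where
  "subgradients G x = {w. \<forall>z\<in>{0..1}. Phi G z - Phi G x \<ge> w * (G z - G x)}"

text \<open>The infimum is an extended real. Where \<open>G x\<close> has its least value \<open>G 0\<close> (in particular at an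
  atom at \<open>0\<close>) the sub-gradients are unbounded below, so the ironed virtual value is \<open>-\<infinity>\<close>. At such
  points, and only there, the set can also be empty, namely when \<open>Phi\<close> as a function of \<open>G\<close> has
  one-sided slope \<open>-\<infinity>\<close>; the value is \<open>-\<infinity>\<close> in that case too, and not \<open>Inf {} = \<infinity>\<close>.\<close>

definition ironed_virtual_value :: "(real \<Rightarrow> real) \<Rightarrow> real \<Rightarrow> ereal" where
  "ironed_virtual_value G x =
     (if subgradients G x = {} then -\<infinity> else (INF w\<in>subgradients G x. ereal w))"

definition virtual_winners :: "nat \<Rightarrow> (nat \<Rightarrow> real \<Rightarrow> real) \<Rightarrow> (nat \<Rightarrow> real) \<Rightarrow> nat set" where
  "virtual_winners n G x = {i \<in> {1..n}. ironed_virtual_value (G i) (x i) \<ge>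
     Max (insert 0 ((\<lambda>j. ironed_virtual_value (G j) (x j)) ` {1..n}))}"

definition winners :: "nat \<Rightarrow> (nat \<Rightarrow> real \<Rightarrow> real) \<Rightarrow> (nat \<Rightarrow> real) \<Rightarrow> nat set" where
  "winners n G x = {i \<in> virtual_winners n G x. \<forall>j \<in> virtual_winners n G x. x i \<ge> x j}"

definition allocation :: "nat \<Rightarrow> (nat \<Rightarrow> real \<Rightarrow> real) \<Rightarrow> (nat \<Rightarrow> real) \<Rightarrow> nat \<Rightarrow> real" where
  "allocation n G x i = (if i \<in> winners n G x then 1 / real (card (winners n G x)) else 0)"

text \<open>A buyer with positive allocation has a non-negative, finite ironed virtual value, so
  \<open>real_of_ereal\<close> is faithful there; all other terms vanish because of the factor \<open>allocation\<close>.\<close>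

definition buyers_surplus :: "nat \<Rightarrow> (nat \<Rightarrow> real \<Rightarrow> real) \<Rightarrow> real" where
  "buyers_surplus n G =
     (LINT x : (\<Pi>\<^sub>E i\<in>{1..n}. {0..1}) | (\<Pi>\<^sub>M i\<in>{1..n}. interval_measure (G i)).
        (\<Sum>i=1..n. (x i - real_of_ereal (ironed_virtual_value (G i) (x i))) * allocation n G x i))"

text \<open>Uniqueness of the maximizer is not required here.\<close>

definition symmetric_buyer_optimal :: "nat \<Rightarrow> real \<Rightarrow> (real \<Rightarrow> real) \<Rightarrow> bool" where
  "symmetric_buyer_optimal n p G \<longleftrightarrow>
     is_arg_max (\<lambda>H. buyers_surplus n (\<lambda>_. H)) (signal_cdf p) G"

text \<open>For two buyers, the symmetric buyer-optimal distribution has an atom at \<open>0\<close> exactly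
  when the mean is below the threshold \<open>r_b\<close>.\<close>

definition theta_b :: real where
  "theta_b = (THE \<theta>. 0 < \<theta> \<and> \<theta> < 1 \<and> 2 * \<theta> + ln (1 - \<theta>) = 0)"

definition r_b :: real where
  "r_b = (1 - theta_b) * (1 - ln (1 - theta_b))"

lemma theta_b_ex1: "\<exists>!\<theta>::real. 0 < \<theta> \<and> \<theta> < 1 \<and> 2 * \<theta> + ln (1 - \<theta>) = 0"
proof -
  define f :: "real \<Rightarrow> real" where "f \<theta> = 2 * \<theta> + ln (1 - \<theta>)" for \<theta>
  have deriv: "(f has_real_derivative 2 - 1 / (1 - \<theta>)) (at \<theta>)" if "\<theta> < 1" for \<theta>
    unfolding f_def using that by (auto intro!: derivative_eq_intros simp: field_simps)
  have cont: "continuous_on {a..b} f" if "b < 1" for a b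
    unfolding f_def using that by (intro continuous_intros) auto
  have crit: "\<exists>z>a. z < b \<and> z = 1/2" if ab: "a < b" "b < 1" "f a = f b" for a b
  proof -
    obtain l z where z: "a < z" "z < b" "(f has_real_derivative l) (at z)" "f b - f a = (b - a) * l"
      using MVT[of a b f] ab cont[of b a] deriv
      by (metis less_trans real_differentiable_def)
    have "l = 2 - 1 / (1 - z)"
      using DERIV_unique[OF z(3) deriv] z(2) ab by simp
    then show ?thesis using z ab by (auto simp: field_simps)
  qed
  have pos: "0 \<le> f (1/2)"
    using ln_add_one_self_le_self[of 1] by (simp add: f_def ln_div)
  have neg: "f (1 - exp (- 2)) \<le> 0"
    by (simp add: f_def)
  have half: "1/2 \<le> 1 - exp (- (2::real))"
    using exp_ge_add_one_self[of 2] by (simp add: exp_minus field_simps)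
  obtain t where t: "1/2 \<le> t" "t \<le> 1 - exp (- 2)" "f t = 0"
    using IVT2'[of f "1 - exp (- 2)" 0 "1/2"] neg pos half cont[of "1 - exp (- 2)"] by auto
  have t1: "t < 1"
    using t(2) exp_gt_zero[of "- 2::real"] by linarith
  have f0: "f 0 = 0" by (simp add: f_def)
  have no_two: False if "0 < a" "a < b" "b < 1" "f a = 0" "f b = 0" for a b
    using crit[of 0 a] crit[of a b] that f0 by auto
  show ?thesis
  proof (rule ex1I[of _ t])
    show "0 < t \<and> t < 1 \<and> 2 * t + ln (1 - t) = 0"
      using t t1 by (simp add: f_def)
  next
    fix u :: real
    assume "0 < u \<and> u < 1 \<and> 2 * u + ln (1 - u) = 0"
    then have "0 < u" "u < 1" "f u = 0" by (auto simp: f_def)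
    then show "u = t"
      using no_two[of u t] no_two[of t u] t t1 by (cases u t rule: linorder_cases) auto
  qed
qed

end

theory Submission
  imports Defs "HOL-Probability.Probability"
begin

text \<open>
  (i) For a symmetric structure with ironed virtual value \<open>\<phi>\<close>, the surplus is the expectation of
  \<open>m - \<phi>\<^sup>+(m)\<close> at the higher signal \<open>m\<close>, at most. Since no posted price earns more than the
  virtual surplus, \<open>z (1 - G z) \<le> \<integral> min (1 - G z) (P (\<phi> > c)) dc\<close>. Adding the mean constraint with a
  Lagrange multiplier turns the surplus into an average over the levels \<open>c\<close> of a function of the
  single number \<open>s = P (\<phi> > c)\<close>, and maximizing over \<open>s\<close> gives a bound attained by a truncated
  Pareto distribution with an atom at \<open>0\<close>. For a pair of truncated Pareto distributions the surplus is
  explicit and affine in the smaller of the two masses at \<open>1\<close>, and moving the two masses apart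
  improves on the symmetric optimum.

  (ii) One buyer with a three-point distribution outbids any number of buyers with
  the known signal \<open>p\<close>, and keeps a rent that does not depend on their number.
\<close>

text \<open>For (i) no symmetric maximizer is constructed: a given one is only compared with a
  number \<open>B\<close> that bounds every symmetric surplus. The multiplier has to make this bound
  tight. With \<open>s\<close> the probability of exceeding a level, revenue averages
  \<open>2 * s - s\<^sup>2\<close> over the levels, while welfare net of the multiplier averages at
  most \<open>tail_weight q0 s\<close>. The difference is stationary at \<open>t0\<close> when
  \<open>2 * t0 + q0 * ln (q0 / t0) = q0 + 1\<close>. Together with the mean condition
  \<open>p = t0 * (1 + ln (q0 / t0))\<close> this fixes \<open>t0\<close> and \<open>q0\<close>, and
  \<open>p < r_b\<close> is what yields \<open>q0 < 1\<close>, that is, an atom of mass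
  \<open>1 - q0\<close> at 0. The obstacle to the bound is that the ironed virtual value is a left
  derivative taken with respect to \<open>G x\<close>, which may jump and be flat. Hence all
  estimates are made with chords of \<open>Phi\<close>, and equalities at jumps and flat pieces hold
  only up to an arbitrary error. For the asymmetric pair the symmetric optimum is stationary, so a
  small change in one mass alone gains nothing to first order. Indifference in the smaller mass
  turns the mixed second-order effect into a first-order gain in the larger mass.\<close>

lemma unit_cdfD:
  assumes "unit_cdf G"
  shows unit_cdf_mono: "x \<le> y \<Longrightarrow> G x \<le> G y"
    and unit_cdf_right_cont: "continuous (at_right x) G"
    and unit_cdf_neg: "x < 0 \<Longrightarrow> G x = 0"
    and unit_cdf_ge_1: "1 \<le> x \<Longrightarrow> G x = 1"
    and unit_cdf_nonneg: "0 \<le> G x"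
    and unit_cdf_le_1: "G x \<le> 1"
proof -
  note u = assms[unfolded unit_cdf_def]
  show m: "x \<le> y \<Longrightarrow> G x \<le> G y" for x y using u by (auto simp: mono_def)
  show "continuous (at_right x) G" "x < 0 \<Longrightarrow> G x = 0" "1 \<le> x \<Longrightarrow> G x = 1" using u by auto
  show "0 \<le> G x"
    using m[of "min x (-1)" x] u by (auto simp: min_def split: if_splits)
  show "G x \<le> 1"
    using m[of x "max x 1"] u by (auto simp: max_def split: if_splits)
qed

subsection \<open>Ironed virtual values\<close>

text \<open>\<open>Phi\<close> is a convex function of the number \<open>G x\<close>, so its least
  sub-gradient is its left derivative, the supremum of these difference quotients. For
  \<open>y\<close> in the unit interval the set is empty when \<open>G y\<close> is the least value
  of \<open>G\<close> there, which is where the virtual value is minus infinity.\<close>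

definition left_slopes :: "(real \<Rightarrow> real) \<Rightarrow> real \<Rightarrow> real set" where
  "left_slopes G y = {(Phi G y - Phi G x) / (G y - G x) | x. x \<in> {0..1} \<and> G x < G y}"

context
  fixes G :: "real \<Rightarrow> real"
  assumes G: "unit_cdf G"
begin

lemma lowest_signal_bounds: "0 \<le> lowest_signal G" "lowest_signal G \<le> 1"
proof -
  have 1: "(1::real) \<in> {x \<in> {0..1}. G x > 0}"
    using unit_cdf_ge_1[OF G] by simp
  then show "0 \<le> lowest_signal G"
    unfolding lowest_signal_def by (intro cInf_greatest) auto
  show "lowest_signal G \<le> 1"
    unfolding lowest_signal_def using 1 by (intro cInf_lower) (auto intro!: bdd_belowI[of _ 0])
qed

lemma cdf_below_lowest_signal:
  assumes "x < lowest_signal G"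
  shows "G x = 0"
proof (rule ccontr)
  assume "G x \<noteq> 0"
  then have pos: "G x > 0" using unit_cdf_nonneg[OF G, of x] by simp
  then have "0 \<le> x" using unit_cdf_neg[OF G, of x] by force
  moreover have "x \<le> 1" using assms lowest_signal_bounds by simp
  ultimately have "lowest_signal G \<le> x"
    unfolding lowest_signal_def using pos by (intro cInf_lower) (auto intro!: bdd_belowI[of _ 0])
  then show False using assms by simp
qed

lemma Psi_1: "Psi G 1 = lowest_signal G"
  using lowest_signal_bounds unit_cdf_ge_1[OF G, of 1] by (simp add: Psi_def)

text \<open>In the plane of \<open>G\<close> and \<open>Psi\<close> this is the line of slope 1
  through the right end point \<open>(1, lowest_signal G)\<close>. It makes \<open>Theta\<close>
  nonempty and is the reason why no virtual value exceeds 1.\<close>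

lemma unit_slope_in_Theta: "(lowest_signal G - 1, 1) \<in> Theta G"
proof -
  have "lowest_signal G - 1 + G x \<le> Psi G x" if "x \<in> {0..1}" for x
  proof (cases "x < lowest_signal G")
    case True
    then show ?thesis
      using cdf_below_lowest_signal lowest_signal_bounds by (simp add: Psi_def)
  next
    case False
    have "x * (1 - G x) \<le> 1 * (1 - G x)"
      using that unit_cdf_le_1[OF G, of x] by (intro mult_right_mono) auto
    then show ?thesis using False by (simp add: Psi_def)
  qed
  then show ?thesis by (auto simp: Theta_def)
qed

lemma Theta_le_Psi:
  assumes "(b, w) \<in> Theta G" "x \<in> {0..1}"
  shows "b + w * G x \<le> Psi G x"
  using assms by (auto simp: Theta_def)

lemma Phi_ge:
  assumes "(b, w) \<in> Theta G" "x \<in> {0..1}"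
  shows "b + w * G x \<le> Phi G x"
proof -
  have "bdd_above ((\<lambda>(b, w). b + w * G x) ` Theta G)"
    using Theta_le_Psi assms(2) by (intro bdd_aboveI[of _ "Psi G x"]) auto
  then show ?thesis
    unfolding Phi_def using assms(1) by (intro cSUP_upper2[of _ _ "(b, w)"]) auto
qed

lemma Phi_leI:
  assumes "\<And>b w. (b, w) \<in> Theta G \<Longrightarrow> b + w * G x \<le> c"
  shows "Phi G x \<le> c"
  unfolding Phi_def using assms unit_slope_in_Theta by (intro cSUP_least) auto

text \<open>\<open>Phi\<close> sees a signal only through its value of \<open>G\<close>, so every
  signal on the same flat piece gives a bound. This matters where the infimum of \<open>Psi\<close>
  over a flat piece is only approached towards its right end.\<close>

lemma Phi_le_Psi:
  assumes "x \<in> {0..1}" "G x = G y"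
  shows "Phi G y \<le> Psi G x"
  using Theta_le_Psi[OF _ assms(1)] assms(2) by (intro Phi_leI) force

lemma Phi_1: "Phi G 1 = lowest_signal G"
  using Phi_le_Psi[of 1 1] Phi_ge[OF unit_slope_in_Theta, of 1] unit_cdf_ge_1[OF G, of 1]
  by (simp add: Psi_1)

lemma Phi_cong: "G x = G y \<Longrightarrow> Phi G x = Phi G y"
  by (simp add: Phi_def)

text \<open>A supremum of affine functions of \<open>G x\<close> is convex in \<open>G x\<close>.
  The slopes are cross-multiplied so that coinciding values of \<open>G\<close> are covered.\<close>

lemma Phi_convex:
  assumes "x \<in> {0..1}" "y \<in> {0..1}" "z \<in> {0..1}" "G x \<le> G y" "G y \<le> G z"
  shows "(Phi G y - Phi G x) * (G z - G y) \<le> (Phi G z - Phi G y) * (G y - G x)"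
proof (cases "G x < G z")
  case False
  then have "G z = G y" "G x = G y" using assms by auto
  then show ?thesis by simp
next
  case True
  have "Phi G y \<le> (Phi G x * (G z - G y) + Phi G z * (G y - G x)) / (G z - G x)"
  proof (rule Phi_leI)
    fix b w assume bw: "(b, w) \<in> Theta G"
    have "(b + w * G y) * (G z - G x) = (b + w * G x) * (G z - G y) + (b + w * G z) * (G y - G x)"
      by (simp add: algebra_simps)
    also have "\<dots> \<le> Phi G x * (G z - G y) + Phi G z * (G y - G x)"
      using assms bw by (intro add_mono mult_right_mono Phi_ge) auto
    finally show "b + w * G y \<le> (Phi G x * (G z - G y) + Phi G z * (G y - G x)) / (G z - G x)"
      using True by (simp add: pos_le_divide_eq)
  qed
  then have "Phi G y * (G z - G x) \<le> Phi G x * (G z - G y) + Phi G z * (G y - G x)"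
    using True by (simp add: pos_le_divide_eq)
  then show ?thesis by (simp add: algebra_simps)
qed

lemma Phi_diff_le_unit_slope:
  assumes "x \<in> {0..1}"
  shows "Phi G 1 - Phi G x \<le> 1 - G x"
  using Phi_ge[OF unit_slope_in_Theta assms] by (simp add: Phi_1)

text \<open>By convexity a slope to the left of \<open>y\<close> is at most the slope from
  \<open>y\<close> to 1, and the latter is at most 1 because \<open>Phi\<close> meets the line of
  \<open>unit_slope_in_Theta\<close> at the signal 1.\<close>

lemma left_slopes_le_1:
  assumes "y \<in> {0..1}" "v \<in> left_slopes G y"
  shows "v \<le> 1"
proof -
  from assms obtain x where x: "x \<in> {0..1}" "G x < G y"
    and v: "v = (Phi G y - Phi G x) / (G y - G x)" by (auto simp: left_slopes_def)
  have 1: "G 1 = 1" using unit_cdf_ge_1[OF G] by simp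
  have "Phi G y - Phi G x \<le> G y - G x"
  proof (cases "G y = 1")
    case True
    then have "Phi G y = Phi G 1" using 1 by (intro Phi_cong) simp
    then show ?thesis using Phi_diff_le_unit_slope[OF x(1)] True by simp
  next
    case False
    then have lt: "G y < 1" using unit_cdf_le_1[OF G, of y] by simp
    have "(Phi G y - Phi G x) * (1 - G y) \<le> (Phi G 1 - Phi G y) * (G y - G x)"
      using Phi_convex[of x y 1] assms x 1 lt by simp
    also have "\<dots> \<le> (1 - G y) * (G y - G x)"
      using Phi_diff_le_unit_slope[OF assms(1)] x by (intro mult_right_mono) auto
    finally show ?thesis using lt by (simp add: mult.commute)
  qed
  then show ?thesis using x v by simp
qed

text \<open>To the left of \<open>y\<close> the supremum dominates each quotient; to the right,
  convexity puts every right quotient above every left one.\<close>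

lemma Sup_left_slopes_in_subgradients:
  assumes y: "y \<in> {0..1}" and ne: "left_slopes G y \<noteq> {}"
  shows "Sup (left_slopes G y) \<in> subgradients G y"
proof -
  have bdd: "bdd_above (left_slopes G y)" using left_slopes_le_1[OF y] by (rule bdd_aboveI)
  have "Sup (left_slopes G y) * (G z - G y) \<le> Phi G z - Phi G y" if z: "z \<in> {0..1}" for z
  proof (cases "G z" "G y" rule: linorder_cases)
    case less
    then have "(Phi G y - Phi G z) / (G y - G z) \<le> Sup (left_slopes G y)"
      using z by (intro cSup_upper bdd) (auto simp: left_slopes_def)
    then have "Phi G y - Phi G z \<le> Sup (left_slopes G y) * (G y - G z)"
      using less by (simp add: pos_divide_le_eq)
    then show ?thesis by (simp add: algebra_simps)
  next
    case equal
    then show ?thesis using Phi_cong[of z y] by simp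
  next
    case greater
    have "Sup (left_slopes G y) \<le> (Phi G z - Phi G y) / (G z - G y)"
    proof (rule cSup_least[OF ne])
      fix v assume "v \<in> left_slopes G y"
      then obtain x where x: "x \<in> {0..1}" "G x < G y"
        and v: "v = (Phi G y - Phi G x) / (G y - G x)" by (auto simp: left_slopes_def)
      show "v \<le> (Phi G z - Phi G y) / (G z - G y)"
        unfolding v using Phi_convex[OF x(1) y z] x greater
        by (simp add: pos_divide_le_eq pos_le_divide_eq mult.commute)
    qed
    then show ?thesis using greater by (simp add: pos_le_divide_eq)
  qed
  then show ?thesis by (auto simp: subgradients_def)
qed

lemma left_slope_le_subgradient:
  assumes "x \<in> {0..1}" "G x < G y" "w \<in> subgradients G y"
  shows "Phi G y - Phi G x \<le> w * (G y - G x)"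
proof -
  have "Phi G x - Phi G y \<ge> w * (G x - G y)" using assms by (auto simp: subgradients_def)
  then show ?thesis by (simp add: algebra_simps)
qed

lemma ironed_virtual_value_eq_Sup:
  assumes y: "y \<in> {0..1}" and gt: "G 0 < G y"
  shows "ironed_virtual_value G y = ereal (Sup (left_slopes G y))"
proof -
  have ne: "left_slopes G y \<noteq> {}" using gt by (force simp: left_slopes_def)
  note sub = Sup_left_slopes_in_subgradients[OF y ne]
  have "Sup (left_slopes G y) \<le> w" if w: "w \<in> subgradients G y" for w
  proof (rule cSup_least[OF ne])
    fix v assume "v \<in> left_slopes G y"
    then show "v \<le> w"
      using left_slope_le_subgradient[OF _ _ w] by (auto simp: left_slopes_def pos_divide_le_eq)
  qed
  then have "(INF w\<in>subgradients G y. ereal w) = ereal (Sup (left_slopes G y))"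
    using sub by (intro antisym INF_lower INF_greatest) auto
  then show ?thesis using sub by (auto simp: ironed_virtual_value_def)
qed

text \<open>The sub-gradient inequality is tested only against values of \<open>G\<close> that are
  no smaller, so it survives any decrease of the slope: a nonempty set of sub-gradients is unbounded
  below.\<close>

lemma ironed_virtual_value_at_least:
  assumes y: "y \<in> {0..1}" and eq: "G y = G 0"
  shows "ironed_virtual_value G y = -\<infinity>"
proof (cases "subgradients G y = {}")
  case True
  then show ?thesis by (simp add: ironed_virtual_value_def)
next
  case False
  then obtain w where w: "w \<in> subgradients G y" by blast
  have less: "v \<in> subgradients G y" if "v \<le> w" for v
  proof -
    have "v * (G z - G y) \<le> Phi G z - Phi G y" if z: "z \<in> {0..1}" for z
    proof -
      have "v * (G z - G y) \<le> w * (G z - G y)"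
        using \<open>v \<le> w\<close> unit_cdf_mono[OF G, of 0 z] z eq by (intro mult_right_mono) auto
      then show ?thesis using w z by (force simp: subgradients_def)
    qed
    then show ?thesis by (auto simp: subgradients_def)
  qed
  have "(INF w\<in>subgradients G y. ereal w) \<le> ereal c" for c
    using less[of "min c w"] by (intro INF_lower2[of "min c w"]) auto
  then have "(INF w\<in>subgradients G y. ereal w) = -\<infinity>"
    by (rule ereal_bot)
  then show ?thesis using False by (simp add: ironed_virtual_value_def)
qed

lemma cdf_0_cases:
  assumes "y \<in> {0..1}"
  obtains "G y = G 0" | "G 0 < G y"
  using unit_cdf_mono[OF G, of 0 y] assms by fastforce

lemma ironed_virtual_value_le_1:
  assumes "y \<in> {0..1}"
  shows "ironed_virtual_value G y \<le> 1"
  using assms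
proof (cases rule: cdf_0_cases)
  case 1
  then show ?thesis using ironed_virtual_value_at_least[OF assms] by simp
next
  case 2
  then have "left_slopes G y \<noteq> {}" by (force simp: left_slopes_def)
  then have "Sup (left_slopes G y) \<le> 1"
    using left_slopes_le_1[OF assms] by (intro cSup_least) auto
  then show ?thesis using ironed_virtual_value_eq_Sup[OF assms 2] by simp
qed

text \<open>The virtual value is the largest left slope at \<open>y\<close>. If it is minus
  infinity, then \<open>G x = G y\<close> and both sides vanish.\<close>

lemma Phi_diff_le_ironed_virtual_value:
  assumes "x \<in> {0..1}" "y \<in> {0..1}" "x \<le> y" "ironed_virtual_value G y \<le> ereal c"
  shows "Phi G y - Phi G x \<le> c * (G y - G x)"
proof (cases "G x < G y")
  case False
  then have "G x = G y" using unit_cdf_mono[OF G assms(3)] by simp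
  then show ?thesis using Phi_cong[of x y] by simp
next
  case True
  then have gt: "G 0 < G y" using unit_cdf_mono[OF G, of 0 x] assms by auto
  then have "left_slopes G y \<noteq> {}" by (force simp: left_slopes_def)
  then have "Phi G y - Phi G x \<le> Sup (left_slopes G y) * (G y - G x)"
    using Sup_left_slopes_in_subgradients assms True by (intro left_slope_le_subgradient) auto
  also have "\<dots> \<le> c * (G y - G x)"
    using True assms ironed_virtual_value_eq_Sup[OF _ gt] by (intro mult_right_mono) auto
  finally show ?thesis .
qed

lemma ironed_virtual_value_mono:
  assumes x: "x \<in> {0..1}" and y: "y \<in> {0..1}" and le: "x \<le> y"
  shows "ironed_virtual_value G x \<le> ironed_virtual_value G y"
  using x
proof (cases rule: cdf_0_cases)
  case 1
  then show ?thesis using ironed_virtual_value_at_least[OF x] by simp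
next
  case 2
  have le': "G x \<le> G y" using unit_cdf_mono[OF G le] .
  then have gt: "G 0 < G y" using 2 by simp
  then have ne: "left_slopes G x \<noteq> {}" "left_slopes G y \<noteq> {}"
    using 2 by (force simp: left_slopes_def)+
  have "Sup (left_slopes G x) \<le> Sup (left_slopes G y)"
  proof (cases "G x = G y")
    case True
    then show ?thesis using Phi_cong[of x y] by (simp add: left_slopes_def)
  next
    case False
    then have lt: "G x < G y" using le' by simp
    have "Phi G y - Phi G x \<ge> Sup (left_slopes G x) * (G y - G x)"
      using Sup_left_slopes_in_subgradients[OF x ne(1)] y by (auto simp: subgradients_def)
    moreover have "Phi G y - Phi G x \<le> Sup (left_slopes G y) * (G y - G x)"
      using Sup_left_slopes_in_subgradients[OF y ne(2)] x lt
      by (intro left_slope_le_subgradient) auto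
    ultimately have "Sup (left_slopes G x) * (G y - G x) \<le> Sup (left_slopes G y) * (G y - G x)"
      by simp
    then show ?thesis using lt by simp
  qed
  then show ?thesis using ironed_virtual_value_eq_Sup x y 2 gt by simp
qed

text \<open>The way to compute virtual values: exhibit a supporting line that touches
  \<open>Phi\<close> at \<open>y\<close> and that \<open>Phi\<close> leaves, to the left of
  \<open>y\<close>, with arbitrarily small extra slope \<open>e\<close>. The slack \<open>e\<close>
  is there for flat pieces of \<open>G\<close> on which the relevant infimum of \<open>Psi\<close>
  is not attained.\<close>

lemma ironed_virtual_value_eqI:
  assumes bw: "(b, w) \<in> Theta G" and y: "y \<in> {0..1}" and touch: "Phi G y \<le> b + w * G y"
    and left: "\<And>e. e > 0 \<Longrightarrow> \<exists>x\<in>{0..1}. G x < G y \<and> Phi G x \<le> b + w * G x + e * (G y - G x)"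
  shows "ironed_virtual_value G y = ereal w"
proof -
  have "w * (G z - G y) \<le> Phi G z - Phi G y" if "z \<in> {0..1}" for z
    using Phi_ge[OF bw that] touch by (simp add: right_diff_distrib)
  then have "w \<in> subgradients G y" by (auto simp: subgradients_def)
  moreover have "w \<le> v" if v: "v \<in> subgradients G y" for v
  proof (rule field_le_epsilon)
    fix e :: real assume "e > 0"
    then obtain x where x: "x \<in> {0..1}" "G x < G y" "Phi G x \<le> b + w * G x + e * (G y - G x)"
      using left by blast
    have "w * (G y - G x) - e * (G y - G x) \<le> Phi G y - Phi G x"
      using x Phi_ge[OF bw y] by (simp add: right_diff_distrib)
    also have "\<dots> \<le> v * (G y - G x)" using left_slope_le_subgradient[OF x(1,2) v] .
    finally have "w * (G y - G x) \<le> (v + e) * (G y - G x)" by (simp add: algebra_simps)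
    then show "w \<le> v + e" using x by simp
  qed
  ultimately have "(INF w\<in>subgradients G y. ereal w) = ereal w"
    by (intro antisym INF_lower INF_greatest) auto
  then show ?thesis using \<open>w \<in> subgradients G y\<close> by (auto simp: ironed_virtual_value_def)
qed

end

subsection \<open>The signal measure\<close>

lemma unit_cdf_limits:
  assumes "unit_cdf G"
  shows "(G \<longlongrightarrow> 0) at_bot" "(G \<longlongrightarrow> 1) at_top"
proof -
  show "(G \<longlongrightarrow> 0) at_bot"
    by (rule tendsto_eventually, rule eventually_mono[OF eventually_le_at_bot[of "-1"]])
      (rule unit_cdf_neg[OF assms], simp)
  show "(G \<longlongrightarrow> 1) at_top"
    by (rule tendsto_eventually, rule eventually_mono[OF eventually_ge_at_top[of 1]])
      (rule unit_cdf_ge_1[OF assms])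
qed

lemma real_distribution_signal:
  assumes "unit_cdf G"
  shows "real_distribution (interval_measure G)"
  by (intro real_distribution_interval_measure unit_cdf_mono[OF assms] unit_cdf_right_cont[OF assms]
      unit_cdf_limits[OF assms])

lemma measure_signal_atMost:
  assumes "unit_cdf G"
  shows "measure (interval_measure G) {..x} = G x"
  by (intro measure_interval_measure_Iic unit_cdf_mono[OF assms] unit_cdf_right_cont[OF assms]
      unit_cdf_limits[OF assms])

lemma measure_signal_greaterThan:
  assumes "unit_cdf G"
  shows "measure (interval_measure G) {x<..} = 1 - G x"
proof -
  interpret real_distribution "interval_measure G" by (rule real_distribution_signal[OF assms])
  have "{x<..} = space (interval_measure G) - {..x}" by auto
  then show ?thesis using prob_compl[of "{..x}"] measure_signal_atMost[OF assms] by simp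
qed

lemma measure_signal_lessThan:
  assumes "unit_cdf G" and "(G \<longlongrightarrow> l) (at_left x)"
  shows "measure (interval_measure G) {..<x} = l"
proof -
  interpret real_distribution "interval_measure G" by (rule real_distribution_signal[OF assms(1)])
  have "cdf (interval_measure G) = G"
    by (simp add: cdf_def fun_eq_iff measure_signal_atMost[OF assms(1)])
  then have "(G \<longlongrightarrow> measure (interval_measure G) {..<x}) (at_left x)"
    using cdf_at_left[of x] by simp
  then show ?thesis using tendsto_unique[OF _ _ assms(2)] by simp
qed

lemma AE_signal_bounds:
  assumes "unit_cdf G"
  shows "AE x in interval_measure G. x \<in> {0..1}"
proof -
  interpret real_distribution "interval_measure G" by (rule real_distribution_signal[OF assms])
  have "(G \<longlongrightarrow> 0) (at_left 0)"
    by (rule tendsto_eventually) (auto simp: eventually_at_filter unit_cdf_neg[OF assms])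
  from measure_signal_lessThan[OF assms this] have "prob {..<0} = 0" .
  moreover have "prob {1<..} = 0"
    using measure_signal_greaterThan[OF assms] unit_cdf_ge_1[OF assms] by simp
  ultimately have "AE x in interval_measure G. x \<notin> {..<0} \<and> x \<notin> {1<..}"
    by (intro AE_conjI AE_not_in) (auto simp: null_sets_def emeasure_eq_measure)
  then show ?thesis by eventually_elim auto
qed

subsection \<open>Layer-cake formulas\<close>

text \<open>Both sides are the area of the region below the graph of \<open>f\<close>.\<close>

lemma (in prob_space) has_integral_tail_prob:
  assumes f[measurable]: "f \<in> borel_measurable M" and bounds: "AE x in M. f x \<in> {0..1::real}"
  shows "((\<lambda>z. prob {x\<in>space M. z < f x}) has_integral expectation f) {0..1}"
proof -
  interpret pair_sigma_finite M lborel ..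
  have mono: "prob {x\<in>space M. z' < f x} \<le> prob {x\<in>space M. z < f x}" if "z \<le> z'" for z z'
    using that by (intro finite_measure_mono) auto
  then have "mono (\<lambda>z. - prob {x\<in>space M. z < f x})" by (auto simp: mono_def)
  then have "(\<lambda>z. - prob {x\<in>space M. z < f x}) \<in> borel_measurable borel"
    by (rule borel_measurable_mono)
  then have [measurable]: "(\<lambda>z. prob {x\<in>space M. z < f x}) \<in> borel_measurable borel"
    by (rule borel_measurable_uminus_eq[THEN iffD1])
  have int: "integrable M f"
    using bounds by (intro integrable_const_bound[of _ 1]) auto
  have "ennreal (expectation f) = (\<integral>\<^sup>+x. ennreal (f x) \<partial>M)"
    using bounds by (intro nn_integral_eq_integral[symmetric] int) auto
  also have "\<dots> = (\<integral>\<^sup>+x. (\<integral>\<^sup>+z. indicator {p. 0 \<le> snd p \<and> snd p \<le> 1 \<and> snd p < f (fst p)} (x, z) \<partial>lborel) \<partial>M)"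
  proof (rule nn_integral_cong_AE, use bounds in eventually_elim)
    fix x assume x: "f x \<in> {0..1}"
    have "(\<integral>\<^sup>+z. indicator {p. 0 \<le> snd p \<and> snd p \<le> 1 \<and> snd p < f (fst p)} (x, z) \<partial>lborel)
        = (\<integral>\<^sup>+z. indicator {0..<f x} z \<partial>lborel)"
      using x by (intro nn_integral_cong) (auto split: split_indicator)
    then show "ennreal (f x) = (\<integral>\<^sup>+z. indicator {p. 0 \<le> snd p \<and> snd p \<le> 1 \<and> snd p < f (fst p)} (x, z) \<partial>lborel)"
      using x by simp
  qed
  also have "\<dots> = (\<integral>\<^sup>+z. (\<integral>\<^sup>+x. indicator {p. 0 \<le> snd p \<and> snd p \<le> 1 \<and> snd p < f (fst p)} (x, z) \<partial>M) \<partial>lborel)"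
    by (rule Fubini'[symmetric]) simp
  also have "\<dots> = (\<integral>\<^sup>+z. ennreal (indicator {0..1} z * prob {x\<in>space M. z < f x}) \<partial>lborel)"
  proof (rule nn_integral_cong)
    fix z :: real
    have "(\<integral>\<^sup>+x. indicator {p. 0 \<le> snd p \<and> snd p \<le> 1 \<and> snd p < f (fst p)} (x, z) \<partial>M)
        = (\<integral>\<^sup>+x. indicator {0..1} z * indicator {x\<in>space M. z < f x} x \<partial>M)"
      by (intro nn_integral_cong) (auto split: split_indicator)
    also have "\<dots> = indicator {0..1} z * emeasure M {x\<in>space M. z < f x}"
      by (subst nn_integral_cmult) auto
    finally show "(\<integral>\<^sup>+x. indicator {p. 0 \<le> snd p \<and> snd p \<le> 1 \<and> snd p < f (fst p)} (x, z) \<partial>M)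
        = ennreal (indicator {0..1} z * prob {x\<in>space M. z < f x})"
      by (simp add: emeasure_eq_measure split: split_indicator)
  qed
  finally have "(\<integral>\<^sup>+z. ennreal (indicator {0..1} z * prob {x\<in>space M. z < f x}) \<partial>lborel) = ennreal (expectation f)" ..
  moreover have "0 \<le> expectation f" using bounds by (intro integral_nonneg_AE) auto
  ultimately have "((\<lambda>z. indicator {0..1} z * prob {x\<in>space M. z < f x}) has_integral expectation f) UNIV"
    by (intro nn_integral_has_integral) auto
  then have "((\<lambda>z. if z \<in> {0..1} then prob {x\<in>space M. z < f x} else 0) has_integral expectation f) UNIV"
    by (rule has_integral_eq[rotated]) auto
  then show ?thesis by (simp only: has_integral_restrict_UNIV)
qed

lemma has_integral_signal_tail:
  assumes "unit_cdf G"
  shows "((\<lambda>z. 1 - G z) has_integral (LINT x|interval_measure G. x)) {0..1}"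
proof -
  interpret real_distribution "interval_measure G" by (rule real_distribution_signal[OF assms])
  have "{x. z < x} = {z<..}" for z :: real by auto
  then show ?thesis
    using has_integral_tail_prob[of "\<lambda>x. x"] AE_signal_bounds[OF assms]
      measure_signal_greaterThan[OF assms] by simp
qed

text \<open>Rewriting \<open>Q (2 q\<^sub>0 - Q) \<le> \<integral> 2 (q\<^sub>0 - q) dq\<close> over \<open>q < min Q q\<^sub>0\<close> and interchanging the
  integrals reduces the left-hand side to the lengths of the level sets of \<open>Q\<close>.\<close>

lemma integral_quadratic_tail_le:
  fixes Q y :: "real \<Rightarrow> real"
  assumes [measurable]: "Q \<in> borel_measurable borel" and Q: "\<And>z. 0 \<le> Q z" and q0: "0 \<le> q0"
    and level: "\<And>z q. 0 \<le> z \<Longrightarrow> z \<le> 1 \<Longrightarrow> 0 < q \<Longrightarrow> q < q0 \<Longrightarrow> q < Q z \<Longrightarrow> z \<le> y q"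
    and J: "((\<lambda>z. Q z * (2 * q0 - Q z)) has_integral J) {0..1}"
    and y: "\<And>q. 0 \<le> y q" and I: "((\<lambda>q. 2 * (q0 - q) * y q) has_integral I) {0..q0}"
  shows "J \<le> I"
proof -
  define S where "S = {p::real\<times>real. 0 \<le> fst p \<and> fst p \<le> 1 \<and> 0 < snd p \<and> snd p < q0 \<and> snd p < Q (fst p)}"
  have "S = {p \<in> space (borel \<Otimes>\<^sub>M borel).
      0 \<le> fst p \<and> fst p \<le> 1 \<and> 0 < snd p \<and> snd p < q0 \<and> snd p < Q (fst p)}"
    by (simp add: S_def space_pair_measure)
  then have [measurable]: "S \<in> sets (borel \<Otimes>\<^sub>M borel)" by simp
  \<comment> \<open>The weight \<open>2 * (q0 - q)\<close> is negative beyond \<open>q0\<close>.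
    Stopping the inner integral at \<open>min (Q z) q0\<close> keeps it nonnegative, as the
    interchange requires, and can only increase the value (\<open>Q_le_f\<close>).\<close>
  define f where "f z = min (Q z) q0 * (2 * q0 - min (Q z) q0)" for z
  have [measurable]: "f \<in> borel_measurable borel" unfolding f_def by measurable
  have f_nonneg: "0 \<le> f z" for z
    unfolding f_def using Q[of z] q0 by (intro mult_nonneg_nonneg) auto
  have f_le: "f z \<le> q0 * (2 * q0)" for z
    unfolding f_def using Q[of z] q0 by (intro mult_mono) auto
  have Q_le_f: "Q z * (2 * q0 - Q z) \<le> f z" for z
  proof (cases "Q z \<le> q0")
    case False
    have "0 \<le> (Q z - q0)\<^sup>2" by simp
    then show ?thesis using False by (simp add: f_def power2_eq_square algebra_simps)
  qed (simp add: f_def)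
  have inner: "ennreal (indicator {0..1} z * f z) = (\<integral>\<^sup>+q. ennreal (2 * (q0 - q)) * indicator S (z, q) \<partial>lborel)" for z
  proof -
    let ?u = "min (Q z) q0"
    have "((\<lambda>q. 2 * (q0 - q)) has_integral (2 * q0 * ?u - ?u\<^sup>2) - (2 * q0 * 0 - 0\<^sup>2)) {0..?u}"
      using Q[of z] q0
      by (intro fundamental_theorem_of_calculus)
        (auto intro!: derivative_eq_intros simp: has_real_derivative_iff_has_vector_derivative[symmetric])
    then have "(\<integral>\<^sup>+q. ennreal (indicator {0..?u} q * (2 * (q0 - q))) \<partial>lborel) = ennreal (f z)"
      by (subst nn_integral_has_integral_lebesgue)
        (auto simp: f_def power2_eq_square algebra_simps)
    moreover have "(\<integral>\<^sup>+q. ennreal (2 * (q0 - q)) * indicator S (z, q) \<partial>lborel)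
        = (\<integral>\<^sup>+q. ennreal (indicator {0..?u} q * (2 * (q0 - q))) * indicator {0..1} z \<partial>lborel)"
      using AE_lborel_singleton[of 0] AE_lborel_singleton[of q0] AE_lborel_singleton[of "Q z"]
      by (intro nn_integral_cong_AE; eventually_elim) (auto simp: S_def split: split_indicator)
    ultimately show ?thesis
      by (auto simp: nn_integral_multc split: split_indicator)
  qed
  have "(\<integral>\<^sup>+z. ennreal (indicator {0..1} z * f z) \<partial>lborel)
      = (\<integral>\<^sup>+q. (\<integral>\<^sup>+z. ennreal (2 * (q0 - q)) * indicator S (z, q) \<partial>lborel) \<partial>lborel)"
    unfolding inner by (rule lborel_pair.Fubini'[symmetric]) measurable
  also have "\<dots> \<le> (\<integral>\<^sup>+q. ennreal (indicator {0..q0} q * (2 * (q0 - q) * y q)) \<partial>lborel)"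
  proof (rule nn_integral_mono)
    fix q :: real
    have "(\<integral>\<^sup>+z. ennreal (2 * (q0 - q)) * indicator S (z, q) \<partial>lborel)
        \<le> (\<integral>\<^sup>+z. ennreal (indicator {0<..<q0} q * (2 * (q0 - q))) * indicator {0..y q} z \<partial>lborel)"
      using level by (intro nn_integral_mono) (auto simp: S_def split: split_indicator)
    also have "\<dots> = ennreal (indicator {0<..<q0} q * (2 * (q0 - q))) * ennreal (y q)"
      using y by (subst nn_integral_cmult) auto
    also have "\<dots> \<le> ennreal (indicator {0..q0} q * (2 * (q0 - q) * y q))"
      using y by (subst ennreal_mult'[symmetric]) (auto split: split_indicator)
    finally show "(\<integral>\<^sup>+z. ennreal (2 * (q0 - q)) * indicator S (z, q) \<partial>lborel)
        \<le> ennreal (indicator {0..q0} q * (2 * (q0 - q) * y q))" .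
  qed
  also have "\<dots> = ennreal I"
    using I y by (intro nn_integral_has_integral_lebesgue) auto
  finally have fI: "(\<integral>\<^sup>+z. ennreal (indicator {0..1} z * f z) \<partial>lborel) \<le> ennreal I" .
  have "0 \<le> I" using y by (intro has_integral_nonneg[OF I]) auto
  \<comment> \<open>Finiteness, known from the bound by \<open>I\<close>, turns the nonnegative
    integral into a gauge integral that can be compared with \<open>J\<close>.\<close>
  obtain r where r: "(\<integral>\<^sup>+z. ennreal (indicator {0..1} z * f z) \<partial>lborel) = ennreal r" "0 \<le> r"
    using fI by (cases "\<integral>\<^sup>+z. ennreal (indicator {0..1} z * f z) \<partial>lborel" rule: ennreal_cases)
      (auto simp: top_unique)
  have "r \<le> I" using fI \<open>0 \<le> I\<close> unfolding r by simp
  have "((\<lambda>z. indicator {0..1} z * f z) has_integral r) UNIV"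
    using r f_nonneg by (intro nn_integral_has_integral) auto
  then have "((\<lambda>z. if z \<in> {0..1} then f z else 0) has_integral r) UNIV"
    by (rule has_integral_eq[rotated]) auto
  then have "(f has_integral r) {0..1}" by (simp only: has_integral_restrict_UNIV)
  then have "J \<le> r" using J Q_le_f by (intro has_integral_le[OF J]) auto
  then show ?thesis using \<open>r \<le> I\<close> by simp
qed

subsection \<open>Two independent signals\<close>

lemma AE_signals_bounds:
  assumes "\<And>i. i \<in> {1..n} \<Longrightarrow> unit_cdf (G i)"
  shows "AE x in (\<Pi>\<^sub>M i\<in>{1..n::nat}. interval_measure (G i)). x \<in> (\<Pi>\<^sub>E i\<in>{1..n}. {0..1})"
proof -
  have "AE x in (\<Pi>\<^sub>M i\<in>{1..n}. interval_measure (G i)). \<forall>i\<in>{1..n}. x i \<in> {0..1}"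
    using assms real_distribution_signal
    by (intro AE_finite_allI AE_PiM_component AE_signal_bounds)
      (auto simp: real_distribution_def)
  then show ?thesis
    using AE_space
  proof eventually_elim
    case (elim x)
    then show ?case by (auto simp: space_PiM PiE_iff)
  qed
qed

lemma PiE_two: "(\<Pi>\<^sub>E i\<in>{1..2::nat}. A i) = {x \<in> extensional {1..2}. x 1 \<in> A 1 \<and> x 2 \<in> A 2}"
proof -
  have 12: "{1..2::nat} = {1, 2}" by auto
  show ?thesis unfolding 12 by (intro set_eqI) (simp add: PiE_iff conj_ac)
qed

context
  fixes G :: "nat \<Rightarrow> real \<Rightarrow> real"
  assumes G: "\<And>i. unit_cdf (G i)"
begin

interpretation real_distribution "interval_measure (G i)" for i
  by (rule real_distribution_signal[OF G])

interpretation product_prob_space "\<lambda>i. interval_measure (G i)" "{1..2::nat}"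
  by (intro product_prob_spaceI) (rule prob_space_axioms)

interpretation finite_product_prob_space "\<lambda>i. interval_measure (G i)" "{1..2::nat}"
  by standard simp

lemma measure_two_box:
  assumes "A \<in> sets borel" "B \<in> sets borel"
  shows "measure (\<Pi>\<^sub>M i\<in>{1..2}. interval_measure (G i)) {x \<in> extensional {1..2}. x 1 \<in> A \<and> x 2 \<in> B}
    = measure (interval_measure (G 1)) A * measure (interval_measure (G 2)) B"
proof -
  let ?X = "\<lambda>i::nat. if i = 1 then A else B"
  have 12: "{1..2::nat} = {1, 2}" by auto
  have "measure (\<Pi>\<^sub>M i\<in>{1..2}. interval_measure (G i)) (\<Pi>\<^sub>E i\<in>{1..2}. ?X i)
      = (\<Prod>i\<in>{1..2}. measure (interval_measure (G i)) (?X i))"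
    using assms by (intro finite_measure_PiM_emb) auto
  moreover have "(\<Pi>\<^sub>E i\<in>{1..2}. ?X i) = {x \<in> extensional {1..2}. x 1 \<in> A \<and> x 2 \<in> B}"
    unfolding PiE_two by simp
  moreover have "(\<Prod>i\<in>{1..2}. measure (interval_measure (G i)) (?X i))
      = measure (interval_measure (G 1)) A * measure (interval_measure (G 2)) B"
    unfolding 12 by simp
  ultimately show ?thesis by simp
qed

lemma measure_two_compl_box:
  assumes "A \<in> sets borel" "B \<in> sets borel"
  shows "measure (\<Pi>\<^sub>M i\<in>{1..2}. interval_measure (G i)) {x \<in> extensional {1..2}. \<not> (x 1 \<in> A \<and> x 2 \<in> B)}
    = 1 - measure (interval_measure (G 1)) A * measure (interval_measure (G 2)) B"
proof -
  let ?P = "\<Pi>\<^sub>M i\<in>{1..2}. interval_measure (G i)"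
  have sp: "space ?P = extensional {1..2}" unfolding space_PiM by (auto simp: PiE_def)
  let ?box = "{x \<in> extensional {1..2}. x 1 \<in> A \<and> x 2 \<in> B}"
  have "(\<Pi>\<^sub>E i\<in>{1..2::nat}. if i = 1 then A else B) \<in> sets ?P"
    using assms by (intro sets_PiM_I_finite) auto
  then have "?box \<in> sets ?P" unfolding PiE_two by simp
  moreover have "{x \<in> extensional {1..2}. \<not> (x 1 \<in> A \<and> x 2 \<in> B)} = space ?P - ?box"
    using sp by auto
  ultimately show ?thesis
    using P.prob_compl[of ?box] measure_two_box[OF assms] by simp
qed

lemma has_integral_expected_max:
  "((\<lambda>z. 1 - G 1 z * G 2 z) has_integral
    (LINT x|(\<Pi>\<^sub>M i\<in>{1..2}. interval_measure (G i)). max (x 1) (x 2))) {0..1}"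
proof -
  let ?P = "\<Pi>\<^sub>M i\<in>{1..2}. interval_measure (G i)"
  have "space ?P = extensional {1..2}" unfolding space_PiM by (auto simp: PiE_def)
  then have "{x \<in> space ?P. z < max (x 1) (x 2)}
      = {x \<in> extensional {1..2}. \<not> (x 1 \<in> {..z} \<and> x 2 \<in> {..z})}" for z
    by auto
  then have "measure ?P {x \<in> space ?P. z < max (x 1) (x 2)} = 1 - G 1 z * G 2 z" for z
    using measure_two_compl_box[of "{..z}" "{..z}"] measure_signal_atMost[OF G] by simp
  moreover have "AE x in ?P. max (x 1) (x 2) \<in> {0..1}"
  proof -
    have "AE x in ?P. x \<in> (\<Pi>\<^sub>E i\<in>{1..2}. {0..1})" using G by (rule AE_signals_bounds)
    then show ?thesis unfolding PiE_two by eventually_elim auto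
  qed
  moreover have "(\<lambda>x. max (x 1) (x 2)) \<in> borel_measurable ?P" by measurable
  ultimately show ?thesis
    using P.has_integral_tail_prob[of "\<lambda>x. max (x 1) (x 2)"] by simp
qed

end

subsection \<open>The surplus of a symmetric structure\<close>

text \<open>Clamping the signal and cutting the value at 0 gives a real-valued monotone, hence
  Borel, function on the whole line. Nothing is lost for the surplus, since negative virtual values
  never win.\<close>

definition pos_virtual_value :: "(real \<Rightarrow> real) \<Rightarrow> real \<Rightarrow> real" where
  "pos_virtual_value G x = real_of_ereal (max 0 (ironed_virtual_value G (min 1 (max 0 x))))"

lemma virtual_winners_iff:
  "i \<in> virtual_winners n G x \<longleftrightarrow> i \<in> {1..n} \<and> 0 \<le> ironed_virtual_value (G i) (x i) \<and>
     (\<forall>j\<in>{1..n}. ironed_virtual_value (G j) (x j) \<le> ironed_virtual_value (G i) (x i))"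
  unfolding virtual_winners_def by auto

context
  fixes G :: "real \<Rightarrow> real"
  assumes G: "unit_cdf G"
begin

interpretation real_distribution "interval_measure G"
  by (rule real_distribution_signal[OF G])

lemma max_0_virtual_value:
  "max 0 (ironed_virtual_value G (min 1 (max 0 x))) = ereal (pos_virtual_value G x)"
proof -
  define v where "v = ironed_virtual_value G (min 1 (max 0 x))"
  have "v \<le> 1" unfolding v_def by (intro ironed_virtual_value_le_1[OF G]) auto
  then show ?thesis
    unfolding pos_virtual_value_def v_def[symmetric] by (cases v) (auto simp: max_def zero_ereal_def)
qed

lemma pos_virtual_value_bounds: "0 \<le> pos_virtual_value G x" "pos_virtual_value G x \<le> 1"
proof -
  show "0 \<le> pos_virtual_value G x"
    unfolding pos_virtual_value_def by (rule real_of_ereal_pos) simp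
  have "ironed_virtual_value G (min 1 (max 0 x)) \<le> 1"
    by (intro ironed_virtual_value_le_1[OF G]) auto
  then have "max 0 (ironed_virtual_value G (min 1 (max 0 x))) \<le> ereal 1"
    by (simp add: one_ereal_def zero_ereal_def)
  then show "pos_virtual_value G x \<le> 1" unfolding max_0_virtual_value by simp
qed

lemma mono_pos_virtual_value: "mono (pos_virtual_value G)"
proof (rule monoI)
  fix x y :: real assume "x \<le> y"
  then have "ironed_virtual_value G (min 1 (max 0 x)) \<le> ironed_virtual_value G (min 1 (max 0 y))"
    by (intro ironed_virtual_value_mono[OF G]) auto
  then have "ereal (pos_virtual_value G x) \<le> ereal (pos_virtual_value G y)"
    unfolding max_0_virtual_value[symmetric] by (auto simp: max_def)
  then show "pos_virtual_value G x \<le> pos_virtual_value G y" by simp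
qed

lemma measurable_pos_virtual_value [measurable]: "pos_virtual_value G \<in> borel_measurable borel"
  by (rule borel_measurable_mono[OF mono_pos_virtual_value])

lemma pos_virtual_value_le_iff:
  assumes "x \<in> {0..1}" "0 \<le> c"
  shows "pos_virtual_value G x \<le> c \<longleftrightarrow> ironed_virtual_value G x \<le> ereal c"
proof -
  have "pos_virtual_value G x \<le> c \<longleftrightarrow> max 0 (ironed_virtual_value G x) \<le> ereal c"
    using max_0_virtual_value[of x] assms(1) by (simp add: min_absorb2 max_absorb2)
  then show ?thesis using assms(2) by (simp add: zero_ereal_def)
qed

text \<open>The signals with positive virtual value at most \<open>c\<close> form a down-set. If it
  contains its supremum \<open>b\<close>, its mass is \<open>G b\<close>; otherwise the mass is the
  left limit of \<open>G\<close> at \<open>b\<close>, which is only approached by signals, whence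
  the error \<open>e\<close>. The alternative \<open>y = z\<close> serves the case where
  \<open>z\<close> already lies beyond that mass.\<close>

lemma exists_signal_near_quantile:
  assumes z: "z \<in> {0..1}" and c: "0 \<le> c" and e: "0 < e"
  shows "\<exists>y\<in>{z..1}. (y = z \<or> ironed_virtual_value G y \<le> ereal c) \<and>
    max (G z) (1 - prob {x. c < pos_virtual_value G x}) - e \<le> G y"
proof -
  let ?A = "{x. pos_virtual_value G x \<le> c}"
  let ?m = "1 - prob {x. c < pos_virtual_value G x}"
  have "{x. c < pos_virtual_value G x} = space (interval_measure G) - ?A" by auto
  then have m: "?m = prob ?A"
    using prob_compl[of ?A] by simp
  have down: "y \<in> ?A" if "x \<in> ?A" "y \<le> x" for x y
    using monoD[OF mono_pos_virtual_value that(2)] that(1) by simp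
  have vv: "ironed_virtual_value G y \<le> ereal c" if "y \<in> ?A" "y \<in> {0..1}" for y
    using pos_virtual_value_le_iff[OF that(2) c] that(1) by simp
  consider "?m \<le> G z" | "1 \<in> ?A" | "G z < ?m" "1 \<notin> ?A" by linarith
  then show ?thesis
  proof cases
    case 1
    then show ?thesis using z e by (intro bexI[of _ z]) auto
  next
    case 2
    have "max (G z) ?m \<le> 1" using unit_cdf_le_1[OF G, of z] by simp
    then have "max (G z) ?m - e \<le> G 1" using e unit_cdf_ge_1[OF G, of 1] by linarith
    moreover have "ironed_virtual_value G 1 \<le> ereal c" by (rule vv[OF 2]) simp
    ultimately show ?thesis using z by (intro bexI[of _ 1] conjI disjI2) simp_all
  next
    case 3
    have "0 \<in> ?A"
      using pos_virtual_value_le_iff[of 0, OF _ c] ironed_virtual_value_at_least[OF G, of 0] by simp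
    have lt1: "x < 1" if "x \<in> ?A" for x using down[OF that, of 1] 3 by force
    define b where "b = Sup ?A"
    have bdd: "bdd_above ?A" using lt1 by (intro bdd_aboveI[of _ 1]) force
    have b_ge: "x \<le> b" if "x \<in> ?A" for x unfolding b_def by (rule cSup_upper[OF that bdd])
    have below: "x \<in> ?A" if "x < b" for x
      using that \<open>0 \<in> ?A\<close> less_cSup_iff[OF _ bdd, of x] down unfolding b_def by (metis empty_iff less_imp_le)
    have "b \<le> 1" unfolding b_def using \<open>0 \<in> ?A\<close> lt1 by (intro cSup_least) (auto intro: less_imp_le)
    show ?thesis
    proof (cases "b \<in> ?A")
      case True
      have "?A = {..b}" using b_ge down[OF True] by auto
      then have mb: "?m = G b" using m measure_signal_atMost[OF G] by simp
      then have "z \<le> b" using unit_cdf_mono[OF G, of b z] 3 by force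
      then show ?thesis
        using mb 3 e z \<open>b \<le> 1\<close> vv[OF True] by (intro bexI[of _ b]) auto
    next
      case False
      have "?A = {..<b}" using b_ge below False by (auto simp: order.strict_iff_order)
      moreover have "cdf (interval_measure G) = G"
        by (simp add: cdf_def fun_eq_iff measure_signal_atMost[OF G])
      ultimately have "(G \<longlongrightarrow> ?m) (at_left b)" using cdf_at_left[of b] m by simp
      then have "\<forall>\<^sub>F y in at_left b. max (G z) (?m - e) < G y"
        using 3 e by (intro order_tendstoD(1)) auto
      moreover have "\<forall>\<^sub>F y in at_left b. y < b" by (simp add: eventually_at_filter)
      ultimately have "\<forall>\<^sub>F y in at_left b. max (G z) (?m - e) < G y \<and> y < b"
        by (rule eventually_conj)
      then obtain y where y: "max (G z) (?m - e) < G y" "y < b"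
        using eventually_happens'[OF trivial_limit_at_left_real] by blast
      have "z \<le> y" using unit_cdf_mono[OF G, of y z] y(1) by force
      then show ?thesis
        using y 3 e z \<open>b \<le> 1\<close> vv[OF below[OF y(2)]] by (intro bexI[of _ y]) auto
    qed
  qed
qed

text \<open>The sub-gradient inequality is telescoped through one signal per level \<open>i / k\<close> of the virtual
  value. The sum is an upper Riemann sum for the integral of the virtual value over the quantiles
  between \<open>G z\<close> and \<open>G y\<close>; working with levels avoids integrals in the quantile variable.\<close>

lemma Phi_diff_le_level_sum:
  fixes z :: real and k j :: nat
  assumes z: "z \<in> {0..1}" and k: "0 < k" and y: "y \<in> {z..1}"
    and le: "ironed_virtual_value G y \<le> ereal (j / k)"
  defines "r \<equiv> \<lambda>i::nat. max (G z) (1 - prob {x. i / k < pos_virtual_value G x})"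
  shows "Phi G y - Phi G z \<le> j / k * (G y - G z) - (\<Sum>i<j. min (G y) (r i) - G z) / k"
  using y le
proof (induction j arbitrary: y)
  case 0
  then show ?case
    using Phi_diff_le_ironed_virtual_value[OF G z, of y 0] z by auto
next
  case (Suc j)
  have r_ge: "G z \<le> r i" for i by (simp add: r_def)
  have r_mono: "r i \<le> r j" if "i \<le> j" for i
  proof -
    have "i / k \<le> j / k" using that by (simp add: divide_right_mono)
    then have "prob {x. j / k < pos_virtual_value G x} \<le> prob {x. i / k < pos_virtual_value G x}"
      by (intro finite_measure_mono) auto
    then show ?thesis by (auto simp: r_def)
  qed
  show ?case
  proof (cases "y = z \<or> ironed_virtual_value G y \<le> ereal (j / k)")
    case True
    have "Phi G y - Phi G z \<le> j / k * (G y - G z) - (\<Sum>i<j. min (G y) (r i) - G z) / k"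
      using True
    proof
      assume "y = z"
      then show ?thesis using r_ge by (simp add: min_absorb1)
    qed (use Suc in blast)
    also have "\<dots> \<le> Suc j / k * (G y - G z) - (\<Sum>i<Suc j. min (G y) (r i) - G z) / k"
      using k by (simp add: field_simps)
    finally show ?thesis .
  next
    case False
    show ?thesis
    proof (rule field_le_epsilon)
      fix e :: real assume e: "e > 0"
      \<comment> \<open>The quantile error \<open>d\<close> is charged once for each of the
        \<open>j\<close> earlier levels and once for the current one, each time with weight
        \<open>1 / k\<close>; the total is \<open>e\<close>.\<close>
      define d where "d = e / (Suc j / k)"
      have d: "d > 0" using e k by (simp add: d_def)
      have "0 \<le> real j / k" by simp
      from exists_signal_near_quantile[OF z this d] obtain x where x: "x \<in> {z..1}"
        and x': "x = z \<or> ironed_virtual_value G x \<le> ereal (j / k)" and Gx: "r j - d \<le> G x"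
        unfolding r_def by blast
      \<comment> \<open>The virtual value at \<open>y\<close> exceeds \<open>j / k\<close> while
        that at \<open>x\<close> does not, and virtual values are monotone.\<close>
      have xy: "x < y"
      proof (rule ccontr)
        assume "\<not> x < y"
        then have "y \<le> x" by simp
        then have "ironed_virtual_value G y \<le> ironed_virtual_value G x"
          using Suc.prems x z by (intro ironed_virtual_value_mono[OF G]) auto
        then show False using False x' \<open>y \<le> x\<close> Suc.prems by auto
      qed
      have Gxy: "G x \<le> G y" using unit_cdf_mono[OF G] xy by simp
      have "Phi G y - Phi G x \<le> Suc j / k * (G y - G x)"
        using Suc.prems x z xy by (intro Phi_diff_le_ironed_virtual_value[OF G]) auto
      moreover have "Phi G x - Phi G z \<le> j / k * (G x - G z) - (\<Sum>i<j. min (G x) (r i) - G z) / k"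
        using x'
      proof
        assume "x = z"
        then show ?thesis using r_ge by (simp add: min_absorb1)
      qed (use Suc.IH x in blast)
      \<comment> \<open>For \<open>i < j\<close>, \<open>r i\<close> is at most \<open>r j\<close>,
        hence at most \<open>G x + d\<close>; so cutting at \<open>G x\<close> instead of
        \<open>G y\<close> costs at most \<open>d\<close> per level.\<close>
      moreover have "(\<Sum>i<j. min (G y) (r i) - G z - d) \<le> (\<Sum>i<j. min (G x) (r i) - G z)"
      proof (rule sum_mono)
        fix i assume "i \<in> {..<j}"
        then have "r i - d \<le> G x" using r_mono[of i] Gx by simp
        then show "min (G y) (r i) - G z - d \<le> min (G x) (r i) - G z" using d by auto
      qed
      then have "((\<Sum>i<j. min (G y) (r i) - G z) - j * d) / k \<le> (\<Sum>i<j. min (G x) (r i) - G z) / k"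
        by (intro divide_right_mono) (auto simp: sum_subtractf)
      ultimately have "Phi G y - Phi G z \<le> Suc j / k * (G y - G x) + j / k * (G x - G z)
          - ((\<Sum>i<j. min (G y) (r i) - G z) - j * d) / k"
        by linarith
      also have "\<dots> = Suc j / k * (G y - G z) - ((\<Sum>i<j. min (G y) (r i) - G z) + (G x - G z)) / k
          + j * d / k"
        using k by (simp add: field_simps)
      also have "\<dots> \<le> Suc j / k * (G y - G z)
          - ((\<Sum>i<j. min (G y) (r i) - G z) + (min (G y) (r j) - G z - d)) / k + j * d / k"
      proof -
        have "((\<Sum>i<j. min (G y) (r i) - G z) + (min (G y) (r j) - G z - d)) / k
            \<le> ((\<Sum>i<j. min (G y) (r i) - G z) + (G x - G z)) / k"
          using Gx by (intro divide_right_mono) auto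
        then show ?thesis by linarith
      qed
      also have "\<dots> = Suc j / k * (G y - G z) - (\<Sum>i<Suc j. min (G y) (r i) - G z) / k + Suc j / k * d"
        using k by (simp add: field_simps)
      also have "Suc j / k * d = e" using k by (simp add: d_def)
      finally show "Phi G y - Phi G z
          \<le> Suc j / k * (G y - G z) - (\<Sum>i<Suc j. min (G y) (r i) - G z) / k + e" .
    qed
  qed
qed

text \<open>The left-hand side is the revenue of the posted price \<open>z\<close>. It is at most
  the chord of \<open>Phi\<close> from \<open>z\<close> to 1, because \<open>Phi\<close> lies below
  \<open>Psi\<close> and agrees with it at 1. \<open>k\<close> levels of width \<open>1 / k\<close>
  suffice since virtual values are at most 1.\<close>

lemma posted_price_revenue_le_level_sum:
  assumes z: "z \<in> {0..1}" and k: "0 < k"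
  shows "z * (1 - G z) \<le> (\<Sum>i<k. min (1 - G z) (prob {x. real i / real k < pos_virtual_value G x})) / k"
proof -
  let ?s = "\<lambda>i. prob {x. real i / real k < pos_virtual_value G x}"
  have G1: "G 1 = 1" using unit_cdf_ge_1[OF G] by simp
  have "z * (1 - G z) \<le> Phi G 1 - Phi G z"
  proof (cases "z < lowest_signal G")
    case True
    have "Phi G z \<le> 0" using Phi_le_Psi[OF G z, of z] True by (simp add: Psi_def)
    then show ?thesis
      using True Phi_1[OF G] cdf_below_lowest_signal[OF G True] by simp
  next
    case False
    then show ?thesis
      using Phi_le_Psi[OF G z, of z] Phi_1[OF G] by (simp add: Psi_def)
  qed
  also have "\<dots> \<le> real k / k * (G 1 - G z) - (\<Sum>i<k. min (G 1) (max (G z) (1 - ?s i)) - G z) / k"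
    using ironed_virtual_value_le_1[OF G, of 1] z k
    by (intro Phi_diff_le_level_sum) (auto simp: one_ereal_def)
  also have "\<dots> = ((\<Sum>i<k. 1 - G z) - (\<Sum>i<k. min 1 (max (G z) (1 - ?s i)) - G z)) / k"
    using k G1 by (simp add: field_simps)
  also have "\<dots> = (\<Sum>i<k. min (1 - G z) (?s i)) / k"
    using unit_cdf_le_1[OF G, of z] prob_le_1
    by (subst sum_subtractf[symmetric], intro arg_cong[of _ _ "\<lambda>u. u / k"] sum.cong) auto
  finally show ?thesis .
qed

text \<open>With a common monotone virtual value the highest signal also has the highest virtual
  value, and ties go to higher signals; so any winner has signal \<open>x i0\<close>. Only an
  inequality holds because the object stays unsold when that virtual value is negative.\<close>

lemma symmetric_surplus_pointwise:
  assumes x: "\<And>i. i \<in> {1..n} \<Longrightarrow> x i \<in> {0..1}" and i0: "i0 \<in> {1..n}"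
    and top: "\<And>i. i \<in> {1..n} \<Longrightarrow> x i \<le> x i0"
  shows "(\<Sum>i=1..n. (x i - real_of_ereal (ironed_virtual_value G (x i))) * allocation n (\<lambda>_. G) x i)
    \<le> x i0 - pos_virtual_value G (x i0)"
proof -
  let ?W = "winners n (\<lambda>_. G) x"
  have vv_top: "ironed_virtual_value G (x i) \<le> ironed_virtual_value G (x i0)" if "i \<in> {1..n}" for i
    using x top that i0 by (intro ironed_virtual_value_mono[OF G]) auto
  have pos: "max 0 (ironed_virtual_value G (x i0)) = ereal (pos_virtual_value G (x i0))"
    using max_0_virtual_value[of "x i0"] x[OF i0] by (simp add: min_absorb2 max_absorb2)
  have sum: "(\<Sum>i=1..n. (x i - real_of_ereal (ironed_virtual_value G (x i))) * allocation n (\<lambda>_. G) x i)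
      = (\<Sum>i\<in>?W. (x i - real_of_ereal (ironed_virtual_value G (x i))) / card ?W)"
    by (rule sum.mono_neutral_cong_right)
      (auto simp: allocation_def winners_def virtual_winners_iff)
  show ?thesis
  proof (cases "0 \<le> ironed_virtual_value G (x i0)")
    case True
    then have i0v: "i0 \<in> virtual_winners n (\<lambda>_. G) x"
      using i0 vv_top by (auto simp: virtual_winners_iff)
    then have "i0 \<in> ?W"
      using top by (auto simp: winners_def virtual_winners_iff)
    moreover have "finite ?W" by (simp add: winners_def virtual_winners_def)
    ultimately have card: "card ?W \<noteq> 0" by auto
    have eq: "x i = x i0" if "i \<in> ?W" for i
    proof -
      have "x i0 \<le> x i" "i \<in> virtual_winners n (\<lambda>_. G) x" using that i0v by (auto simp: winners_def)
      then show ?thesis using top[of i] by (simp add: virtual_winners_iff)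
    qed
    have "real_of_ereal (ironed_virtual_value G (x i0)) = pos_virtual_value G (x i0)"
      using pos True by (simp add: max_absorb2)
    then have "(\<Sum>i\<in>?W. (x i - real_of_ereal (ironed_virtual_value G (x i))) / card ?W)
        = (\<Sum>i\<in>?W. (x i0 - pos_virtual_value G (x i0)) / card ?W)"
      using eq by (intro sum.cong) auto
    then show ?thesis unfolding sum using card by simp
  next
    case False
    then have "i \<notin> virtual_winners n (\<lambda>_. G) x" for i
      using vv_top[of i] order_trans[of 0] by (auto simp: virtual_winners_iff)
    then have "?W = {}" by (auto simp: winners_def)
    moreover have "pos_virtual_value G (x i0) = 0"
      using pos False by (simp add: max_absorb1)
    ultimately show ?thesis unfolding sum using x[OF i0] by simp
  qed
qed

end

text \<open>Closed form of the integral in \<open>has_integral_tail_weight\<close>: what a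
  virtual-value level exceeded with probability \<open>s\<close> can contribute to welfare, net of
  the multiplier on the mean.\<close>

definition tail_weight :: "real \<Rightarrow> real \<Rightarrow> real" where
  "tail_weight q0 s = (if q0 \<le> s then q0\<^sup>2 else s\<^sup>2 + 2 * q0 * s * ln (q0 / s))"

lemma has_integral_tail_weight:
  assumes q0: "0 < q0" and s: "0 \<le> s"
  shows "((\<lambda>q. 2 * (q0 - q) * min 1 (s / q)) has_integral tail_weight q0 s) {0..q0}"
proof -
  have sq: "((\<lambda>q. 2 * (q0 - q)) has_integral (2 * q0 * u - u\<^sup>2) - (2 * q0 * 0 - 0\<^sup>2)) {0..u}"
    if "0 \<le> u" for u
    using that
    by (intro fundamental_theorem_of_calculus)
      (auto intro!: derivative_eq_intros simp: has_real_derivative_iff_has_vector_derivative[symmetric])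
  consider "s = 0" | "q0 \<le> s" | "0 < s" "s < q0" using s by linarith
  then show ?thesis
  proof cases
    case 1
    then show ?thesis using q0 by (simp add: tail_weight_def)
  next
    case 2
    have "((\<lambda>q. 2 * (q0 - q) * min 1 (s / q)) has_integral (2 * q0 * q0 - q0\<^sup>2) - (2 * q0 * 0 - 0\<^sup>2)) {0..q0}"
    proof (rule has_integral_spike_finite[OF _ _ sq])
      show "finite {0::real}" by simp
      show "2 * (q0 - q) * min 1 (s / q) = 2 * (q0 - q)" if "q \<in> {0..q0} - {0}" for q
        using that 2 by (simp add: min_absorb1)
    qed (use q0 in simp)
    then show ?thesis using 2 by (simp add: tail_weight_def power2_eq_square)
  next
    case 3
    have "((\<lambda>q. 2 * (q0 - q) * min 1 (s / q)) has_integral (2 * q0 * s - s\<^sup>2) - (2 * q0 * 0 - 0\<^sup>2)) {0..s}"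
    proof (rule has_integral_spike_finite[OF _ _ sq])
      show "finite {0::real}" by simp
      show "2 * (q0 - q) * min 1 (s / q) = 2 * (q0 - q)" if "q \<in> {0..s} - {0}" for q
        using that by (simp add: min_absorb1)
    qed (use 3 in simp)
    moreover have "((\<lambda>q. 2 * (q0 - q) * min 1 (s / q)) has_integral
        (2 * q0 * s * ln q0 - 2 * s * q0) - (2 * q0 * s * ln s - 2 * s * s)) {s..q0}"
    proof (rule has_integral_eq)
      show "((\<lambda>q. 2 * q0 * s / q - 2 * s) has_integral
          (2 * q0 * s * ln q0 - 2 * s * q0) - (2 * q0 * s * ln s - 2 * s * s)) {s..q0}"
        using 3 by (intro fundamental_theorem_of_calculus)
          (auto intro!: derivative_eq_intros simp: has_real_derivative_iff_has_vector_derivative[symmetric])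
      show "2 * q0 * s / q - 2 * s = 2 * (q0 - q) * min 1 (s / q)" if "q \<in> {s..q0}" for q
        using that 3 by (simp add: min_absorb2 field_simps)
    qed
    ultimately have "((\<lambda>q. 2 * (q0 - q) * min 1 (s / q)) has_integral
        ((2 * q0 * s - s\<^sup>2) - (2 * q0 * 0 - 0\<^sup>2))
        + ((2 * q0 * s * ln q0 - 2 * s * q0) - (2 * q0 * s * ln s - 2 * s * s))) {0..q0}"
      using 3 by (intro has_integral_combine[of 0 s q0]) auto
    then show ?thesis
      using 3 by (simp add: tail_weight_def ln_div power2_eq_square algebra_simps)
  qed
qed

text \<open>Lagrangian bound with multiplier \<open>1 - q0\<close> on the mean. After discretizing the virtual
  value into \<open>k\<close> levels the bound is an average of one-dimensional problems, one for the probability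
  of exceeding each level, up to an error of \<open>1 / k\<close>.\<close>

lemma symmetric_surplus_le:
  assumes G: "unit_cdf G" and q0: "0 < q0" "q0 < 1" and C: "0 \<le> C"
    and bound: "\<And>s. 0 \<le> s \<Longrightarrow> s \<le> 1 \<Longrightarrow> tail_weight q0 s - 2 * s + s\<^sup>2 \<le> C"
  shows "buyers_surplus 2 (\<lambda>_. G) \<le> 2 * (1 - q0) * (LINT x|interval_measure G. x) + C"
proof -
  interpret real_distribution "interval_measure G" by (rule real_distribution_signal[OF G])
  interpret PP: product_prob_space "\<lambda>_::nat. interval_measure G" "{1..2}"
    by (intro product_prob_spaceI) (rule prob_space_axioms)
  let ?P = "\<Pi>\<^sub>M i\<in>{1..2::nat}. interval_measure G"
  let ?p = "LINT x|interval_measure G. x"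
  let ?f = "\<lambda>x. \<Sum>i=1..2. (x i - real_of_ereal (ironed_virtual_value G (x i))) * allocation 2 (\<lambda>_. G) x i"
  let ?F = "\<lambda>x. indicator (\<Pi>\<^sub>E i\<in>{1..2}. {0..1}) x * ?f x"
  define m :: "(nat \<Rightarrow> real) \<Rightarrow> real" where "m x = max (x 1) (x 2)" for x
  let ?g = "pos_virtual_value G"
  note One_nat_def [simp del]
  note [measurable] = measurable_pos_virtual_value[OF G]
  have [measurable]: "m \<in> borel_measurable ?P"
    unfolding m_def by measurable
  have AE: "AE x in ?P. x \<in> (\<Pi>\<^sub>E i\<in>{1..2}. {0..1})"
    using G by (intro AE_signals_bounds)
  have "AE x in ?P. norm (m x) \<le> 1"
    using AE unfolding PiE_two m_def by eventually_elim auto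
  then have m_int: "integrable ?P m"
    by (rule PP.P.integrable_const_bound) simp
  have g_int: "integrable ?P (\<lambda>x. ?g (m x))"
    using pos_virtual_value_bounds[OF G] by (intro PP.P.integrable_const_bound[of _ 1]) auto
  have p_nonneg: "0 \<le> ?p"
    using AE_signal_bounds[OF G] by (intro integral_nonneg_AE) auto
  have main: "buyers_surplus 2 (\<lambda>_. G) \<le> 2 * (1 - q0) * ?p + C + 1 / k"
    if int: "integrable ?P ?F" and k: "k > 0" for k :: nat
  proof -
    define s where "s j = prob {x. real j / real k < ?g x}" for j :: nat
    have s01: "0 \<le> s j" "s j \<le> 1" for j by (auto simp: s_def)
    have "buyers_surplus 2 (\<lambda>_. G) = (LINT x|?P. ?F x)"
      by (simp add: buyers_surplus_def set_lebesgue_integral_def)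
    also have "\<dots> \<le> (LINT x|?P. m x - ?g (m x))"
    proof (rule integral_mono_AE[OF int])
      show "integrable ?P (\<lambda>x. m x - ?g (m x))" using m_int g_int by simp
      show "AE x in ?P. ?F x \<le> m x - ?g (m x)"
        using AE
      proof eventually_elim
        case (elim x)
        then have x: "x i \<in> {0..1}" if "i \<in> {1..2}" for i using that by (auto simp: PiE_iff)
        obtain i0 :: nat where i0: "i0 \<in> {1..2}" "m x = x i0" "\<And>i. i \<in> {1..2} \<Longrightarrow> x i \<le> x i0"
        proof (cases "x 1 \<le> x 2")
          case True
          have "x i \<le> x 2" if "i \<in> {1..2}" for i
          proof -
            have "i = 1 \<or> i = 2" using that by auto
            then show ?thesis using True by auto
          qed
          then show ?thesis using True by (intro that[of 2]) (auto simp: m_def)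
        next
          case False
          have "x i \<le> x 1" if "i \<in> {1..2}" for i
          proof -
            have "i = 1 \<or> i = 2" using that by auto
            then show ?thesis using False by auto
          qed
          then show ?thesis using False by (intro that[of 1]) (auto simp: m_def)
        qed
        have "?f x \<le> m x - ?g (m x)"
          unfolding i0(2) using x i0(1,3) by (intro symmetric_surplus_pointwise[OF G])
        then show ?case using elim by simp
      qed
    qed
    also have "\<dots> = (LINT x|?P. m x) - (LINT x|?P. ?g (m x))"
      using m_int g_int by simp
    finally have surplus: "buyers_surplus 2 (\<lambda>_. G) \<le> (LINT x|?P. m x) - (LINT x|?P. ?g (m x))" .
    \<comment> \<open>A number in the unit interval is approximated by the share of levels
      \<open>j / k\<close> below it. At most \<open>g u * k + 1\<close> levels are counted, which is
      the source of the error \<open>1 / k\<close>.\<close>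
    have revenue: "(LINT x|?P. ?g (m x)) \<ge> (\<Sum>j<k. 2 * s j - (s j)\<^sup>2) / k - 1 / k"
    proof -
      have level: "(\<Sum>j<k. indicator {x. real j / real k < ?g x} u) / k - 1 / k \<le> ?g u" for u :: real
      proof -
        have "{j. j < k \<and> real j / real k < ?g u} \<subseteq> {..<nat \<lceil>?g u * k\<rceil>}"
          using k by (auto simp: pos_divide_less_eq) linarith
        then have "card {j. j < k \<and> real j / real k < ?g u} \<le> nat \<lceil>?g u * k\<rceil>"
          using card_mono[of "{..<nat \<lceil>?g u * k\<rceil>}"] by simp
        moreover have "0 \<le> ?g u * k" using pos_virtual_value_bounds(1)[OF G, of u] by simp
        ultimately have "real (card {j. j < k \<and> real j / real k < ?g u}) \<le> ?g u * k + 1"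
          by linarith
        moreover have "(\<Sum>j<k. indicator {x. real j / real k < ?g x} u)
            = real (card {j. j < k \<and> real j / real k < ?g u})"
          by (simp add: indicator_def sum.If_cases Int_def)
        ultimately show ?thesis using k by (simp add: field_simps)
      qed
      have prob: "measure ?P {x \<in> space ?P. real j / real k < ?g (m x)} = 2 * s j - (s j)\<^sup>2" for j
      proof -
        let ?A = "{x. ?g x \<le> real j / real k}"
        \<comment> \<open>By monotonicity the virtual value at the maximum stays below a level
          exactly when both signals lie in \<open>?A\<close>, so the complementary event is a
          box.\<close>
        have g_max: "?g (max a b) = max (?g a) (?g b)" for a b
          using mono_pos_virtual_value[OF G] by (simp add: max_of_mono)
        have "space ?P = extensional {1..2}" unfolding space_PiM by (auto simp: PiE_def)
        then have "{x \<in> space ?P. real j / real k < ?g (m x)}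
            = {x \<in> extensional {1..2}. \<not> (x 1 \<in> ?A \<and> x 2 \<in> ?A)}"
          by (auto simp: m_def g_max)
        then have "measure ?P {x \<in> space ?P. real j / real k < ?g (m x)} = 1 - prob ?A * prob ?A"
          using measure_two_compl_box[of "\<lambda>_. G" ?A ?A] G by simp
        moreover have "{x. real j / real k < ?g x} = space (interval_measure G) - ?A" by auto
        then have "s j = 1 - prob ?A" unfolding s_def using prob_compl[of ?A] by simp
        then have "prob ?A = 1 - s j" by simp
        ultimately show ?thesis by (simp add: power2_eq_square algebra_simps)
      qed
      have "(LINT x|?P. (\<Sum>j<k. indicator {x \<in> space ?P. real j / real k < ?g (m x)} x) / k - 1 / k)
          \<le> (LINT x|?P. ?g (m x))"
      proof (rule integral_mono[OF _ g_int])
        show "integrable ?P (\<lambda>x. (\<Sum>j<k. indicator {x \<in> space ?P. real j / real k < ?g (m x)} x) / k - 1 / k :: real)"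
          by (intro Bochner_Integration.integrable_diff integrable_divide_zero
              Bochner_Integration.integrable_sum integrable_real_indicator)
            (auto simp: PP.P.emeasure_eq_measure)
        show "(\<Sum>j<k. indicator {x \<in> space ?P. real j / real k < ?g (m x)} x) / k - 1 / k \<le> ?g (m x)"
          if "x \<in> space ?P" for x
          using level[of "m x"] that by (simp add: indicator_def)
      qed
      also have "(LINT x|?P. (\<Sum>j<k. indicator {x \<in> space ?P. real j / real k < ?g (m x)} x) / k - 1 / k)
          = (\<Sum>j<k. 2 * s j - (s j)\<^sup>2) / k - 1 / k"
        by (subst Bochner_Integration.integral_diff)
          (auto simp: PP.P.emeasure_eq_measure prob PP.P.prob_space
            intro!: integrable_real_indicator Bochner_Integration.integrable_sum integrable_divide_zero)
      finally show ?thesis .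
    qed
    \<comment> \<open>The expected maximum integrates \<open>?Q z * (2 - ?Q z)\<close>. Subtracting
      \<open>2 * (1 - q0)\<close> times the mean replaces 2 by \<open>2 * q0\<close>, the form that
      \<open>integral_quadratic_tail_le\<close> bounds.\<close>
    have welfare: "(LINT x|?P. m x) \<le> (\<Sum>j<k. tail_weight q0 (s j)) / k + 2 * (1 - q0) * ?p"
    proof -
      let ?Q = "\<lambda>z. 1 - G z"
      have "((\<lambda>z. (1 - G z * G z) - 2 * (1 - q0) * (1 - G z)) has_integral
          (LINT x|?P. m x) - 2 * (1 - q0) * ?p) {0..1}"
        using has_integral_expected_max[of "\<lambda>_. G"] G unfolding m_def
        by (intro has_integral_diff has_integral_mult_right has_integral_signal_tail) auto
      then have J: "((\<lambda>z. ?Q z * (2 * q0 - ?Q z)) has_integral (LINT x|?P. m x) - 2 * (1 - q0) * ?p) {0..1}"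
        by (rule has_integral_eq[rotated]) (simp add: algebra_simps)
      have I: "((\<lambda>q. \<Sum>j<k. 2 * (q0 - q) * min 1 (s j / q) / k) has_integral
          (\<Sum>j<k. tail_weight q0 (s j) / k)) {0..q0}"
        using q0 s01 by (intro has_integral_sum has_integral_divide has_integral_tail_weight) auto
      have "(LINT x|?P. m x) - 2 * (1 - q0) * ?p \<le> (\<Sum>j<k. tail_weight q0 (s j) / k)"
      \<comment> \<open>The function \<open>y\<close> bounds how long the tail \<open>?Q\<close> can
        stay above \<open>q\<close>. It is set to 0 for \<open>q \<le> 0\<close>, where
        \<open>s j / q\<close> could be negative.\<close>
      proof (rule integral_quadratic_tail_le[where Q = ?Q and y = "\<lambda>q. if q \<le> 0 then 0 else (\<Sum>j<k. min 1 (s j / q)) / k"])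
        have "mono G" using G by (auto simp: unit_cdf_def)
        then show "?Q \<in> borel_measurable borel"
          using borel_measurable_mono[of G] by measurable
        show "0 \<le> ?Q z" for z using unit_cdf_le_1[OF G, of z] by simp
        show "0 \<le> q0" using q0 by simp
        show "0 \<le> (if q \<le> 0 then 0 else (\<Sum>j<k. min 1 (s j / q)) / k)" for q
          using s01 by (auto intro!: divide_nonneg_nonneg sum_nonneg)
        show "z \<le> (if q \<le> 0 then 0 else (\<Sum>j<k. min 1 (s j / q)) / k)"
          if z: "0 \<le> z" "z \<le> 1" and q: "0 < q" "q < ?Q z" for z q
        proof -
          \<comment> \<open>Posted-price revenue at \<open>z\<close>, divided by
            \<open>?Q z\<close>, bounds the price \<open>z\<close> itself; lowering
            \<open>?Q z\<close> to \<open>q\<close> only weakens the bound.\<close>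
          have "z * ?Q z \<le> (\<Sum>j<k. min (?Q z) (s j)) / k"
            using posted_price_revenue_le_level_sum[OF G _ k, of z] z by (simp add: s_def)
          also have "\<dots> = (\<Sum>j<k. min 1 (s j / ?Q z)) / k * ?Q z"
            using q by (auto simp: sum_distrib_right min_mult_distrib_right intro!: sum.cong)
          finally have "z \<le> (\<Sum>j<k. min 1 (s j / ?Q z)) / k"
            by (rule mult_right_le_imp_le) (use q in simp)
          also have "\<dots> \<le> (\<Sum>j<k. min 1 (s j / q)) / k"
            using q s01 by (intro divide_right_mono sum_mono min.mono divide_left_mono) auto
          finally show ?thesis using q by simp
        qed
        show "((\<lambda>z. ?Q z * (2 * q0 - ?Q z)) has_integral (LINT x|?P. m x) - 2 * (1 - q0) * ?p) {0..1}"
          by (rule J)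
        show "((\<lambda>q. 2 * (q0 - q) * (if q \<le> 0 then 0 else (\<Sum>j<k. min 1 (s j / q)) / k)) has_integral
            (\<Sum>j<k. tail_weight q0 (s j) / k)) {0..q0}"
        proof (rule has_integral_spike_finite[OF _ _ I])
          show "finite {0::real}" by simp
        qed (auto simp: sum_distrib_left sum_divide_distrib mult.assoc)
      qed
      then show ?thesis by (simp add: sum_divide_distrib)
    qed
    have "buyers_surplus 2 (\<lambda>_. G) \<le> (\<Sum>j<k. tail_weight q0 (s j)) / k + 2 * (1 - q0) * ?p
        - ((\<Sum>j<k. 2 * s j - (s j)\<^sup>2) / k - 1 / k)"
      using surplus revenue welfare by linarith
    also have "\<dots> = 2 * (1 - q0) * ?p + (\<Sum>j<k. tail_weight q0 (s j) - 2 * s j + (s j)\<^sup>2) / k + 1 / k"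
      by (simp add: sum.distrib sum_subtractf diff_divide_distrib add_divide_distrib)
    also have "\<dots> \<le> 2 * (1 - q0) * ?p + (\<Sum>j<k. C) / k + 1 / k"
      using bound s01 by (intro add_mono divide_right_mono sum_mono) auto
    finally show ?thesis using k by simp
  qed
  show ?thesis
  proof (cases "integrable ?P ?F")
    \<comment> \<open>A non-integrable function has integral 0 by convention, and the claimed bound
      is nonnegative.\<close>
    case False
    then have "buyers_surplus 2 (\<lambda>_. G) = 0"
      by (simp add: buyers_surplus_def set_lebesgue_integral_def not_integrable_integral_eq)
    then show ?thesis using q0 C p_nonneg by simp
  next
    case True
    show ?thesis
    proof (rule field_le_epsilon)
      fix e :: real assume e: "e > 0"
      obtain k :: nat where k: "k > 0" "1 / k < e"
        using nat_approx_posE[OF e] by (metis of_nat_Suc zero_less_Suc of_nat_0_less_iff)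
      show "buyers_surplus 2 (\<lambda>_. G) \<le> 2 * (1 - q0) * ?p + C + e"
        using main[OF True k(1)] k(2) by simp
    qed
  qed
qed

subsection \<open>Evaluating the surplus\<close>

text \<open>The set is an up-set, so its indicator is monotone. It is treated separately because
  \<open>pos_virtual_value\<close> cannot tell a zero virtual value, which may win, from a negative
  one, which may not.\<close>

lemma measurable_nonneg_virtual_value:
  assumes G: "unit_cdf G"
  shows "{x. 0 \<le> ironed_virtual_value G (min 1 (max 0 x))} \<in> sets borel"
proof -
  let ?A = "{x. 0 \<le> ironed_virtual_value G (min 1 (max 0 x))}"
  have "y \<in> ?A" if "x \<in> ?A" "x \<le> y" for x y
    using that ironed_virtual_value_mono[OF G, of "min 1 (max 0 x)" "min 1 (max 0 y)"]
    by (auto intro: order_trans)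
  then have "mono (indicator ?A :: real \<Rightarrow> real)"
    by (intro monoI) (auto simp: indicator_def)
  then have "(indicator ?A :: real \<Rightarrow> real) \<in> borel_measurable borel"
    by (rule borel_measurable_mono)
  then show ?thesis by (simp add: borel_measurable_indicator_iff)
qed

text \<open>On the cube, winning and the payoff of a winner can be expressed by the measurable functions
  \<open>pos_virtual_value\<close>.\<close>

lemma measurable_surplus_integrand:
  assumes G: "\<And>i. i \<in> {1..n} \<Longrightarrow> unit_cdf (G i)"
  shows "(\<lambda>x. indicator (\<Pi>\<^sub>E i\<in>{1..n}. {0..1}) x *
      (\<Sum>i=1..n. (x i - real_of_ereal (ironed_virtual_value (G i) (x i))) * allocation n G x i))
    \<in> borel_measurable (\<Pi>\<^sub>M i\<in>{1..n}. interval_measure (G i))"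
    (is "?F \<in> borel_measurable ?P")
proof -
  define I where "I = {1..n}"
  define A where "A i = {x. 0 \<le> ironed_virtual_value (G i) (min 1 (max 0 x))}" for i
  define g where "g i = pos_virtual_value (G i)" for i
  define V where "V i x \<longleftrightarrow> x i \<in> A i \<and> (\<forall>j\<in>{1..n}. g j (x j) \<le> g i (x i))" for i x
  define W where "W i x \<longleftrightarrow> V i x \<and> (\<forall>j\<in>{1..n}. V j x \<longrightarrow> x j \<le> x i)" for i x
  have [simp]: "finite I" by (simp add: I_def)
  have [measurable]: "A i \<in> sets borel" "g i \<in> borel_measurable borel" if "i \<in> I" for i
    using measurable_nonneg_virtual_value[OF G] measurable_pos_virtual_value[OF G] that
    by (simp_all add: A_def g_def I_def)
  have gm: "(\<lambda>x. g i (x i)) \<in> borel_measurable (\<Pi>\<^sub>M i\<in>I. interval_measure (G i))"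
    if [simp]: "i \<in> I" for i
    by measurable
  have [measurable]: "Measurable.pred (\<Pi>\<^sub>M i\<in>I. interval_measure (G i)) (\<lambda>x. g j (x j) \<le> g i (x i))"
    if "i \<in> I" "j \<in> I" for i j
    unfolding pred_def by (rule borel_measurable_le[OF gm[OF that(2)] gm[OF that(1)]])
  have [measurable]: "Measurable.pred (\<Pi>\<^sub>M i\<in>I. interval_measure (G i)) (V i)" if [simp]: "i \<in> I" for i
    unfolding V_def I_def[symmetric] by measurable
  have xm: "(\<lambda>x. x i) \<in> borel_measurable (\<Pi>\<^sub>M i\<in>I. interval_measure (G i))"
    if [simp]: "i \<in> I" for i
    by measurable
  have [measurable]: "Measurable.pred (\<Pi>\<^sub>M i\<in>I. interval_measure (G i)) (\<lambda>x. x j \<le> x i)"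
    if "i \<in> I" "j \<in> I" for i j
    unfolding pred_def by (rule borel_measurable_le[OF xm[OF that(2)] xm[OF that(1)]])
  have [measurable]: "Measurable.pred (\<Pi>\<^sub>M i\<in>I. interval_measure (G i)) (W i)" if [simp]: "i \<in> I" for i
    unfolding W_def I_def[symmetric] by measurable
  have C: "(\<Pi>\<^sub>E i\<in>I. {0..1::real}) \<in> sets (\<Pi>\<^sub>M i\<in>I. interval_measure (G i))"
    by (intro sets_PiM_I_finite) auto
  have "(\<lambda>x. indicator (\<Pi>\<^sub>E i\<in>I. {0..1}) x *
      (\<Sum>i\<in>I. (x i - g i (x i)) * (if W i x then 1 / (\<Sum>j\<in>I. if W j x then 1 else 0) else 0)))
    \<in> borel_measurable (\<Pi>\<^sub>M i\<in>I. interval_measure (G i))"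
    by (intro borel_measurable_times borel_measurable_sum borel_measurable_indicator C) measurable
  then have "(\<lambda>x. indicator (\<Pi>\<^sub>E i\<in>{1..n}. {0..1}) x *
      (\<Sum>i\<in>{1..n}. (x i - g i (x i)) * (if W i x then 1 / (\<Sum>j\<in>{1..n}. if W j x then 1 else 0) else 0)))
    \<in> borel_measurable ?P"
    unfolding I_def .
  also have "?this \<longleftrightarrow> ?F \<in> borel_measurable ?P"
  proof (rule measurable_cong)
    fix x
    show "indicator (\<Pi>\<^sub>E i\<in>{1..n}. {0..1}) x *
        (\<Sum>i\<in>{1..n}. (x i - g i (x i)) * (if W i x then 1 / (\<Sum>j\<in>{1..n}. if W j x then 1 else 0) else 0))
      = ?F x"
    proof (cases "x \<in> (\<Pi>\<^sub>E i\<in>{1..n}. {0..1})")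
      case True
      have clamp: "min 1 (max 0 (x i)) = x i" if "i \<in> {1..n}" for i
      proof -
        have "x i \<in> {0..1}" using True that by (auto simp: PiE_iff)
        then show ?thesis by (simp add: max_absorb2 min_absorb2)
      qed
      have g: "ereal (g i (x i)) = max 0 (ironed_virtual_value (G i) (x i))" if "i \<in> {1..n}" for i
        using max_0_virtual_value[OF G[OF that], of "x i"] clamp[OF that] by (simp add: g_def)
      have g_le: "g j (x j) \<le> g i (x i) \<longleftrightarrow>
          max 0 (ironed_virtual_value (G j) (x j)) \<le> max 0 (ironed_virtual_value (G i) (x i))"
        if "i \<in> {1..n}" "j \<in> {1..n}" for i j
        using g[OF that(1)] g[OF that(2)] by (metis ereal_less_eq(3))
      have V: "V i x \<longleftrightarrow> i \<in> virtual_winners n G x" if i: "i \<in> {1..n}" for i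
      proof -
        have "x i \<in> A i \<longleftrightarrow> 0 \<le> ironed_virtual_value (G i) (x i)"
          using clamp[OF i] by (simp add: A_def)
        moreover have "g j (x j) \<le> g i (x i) \<longleftrightarrow>
            ironed_virtual_value (G j) (x j) \<le> ironed_virtual_value (G i) (x i)"
          if "0 \<le> ironed_virtual_value (G i) (x i)" "j \<in> {1..n}" for j
          using g_le[OF i that(2)] that(1) by (simp add: max_absorb2)
        ultimately show ?thesis using i by (auto simp: V_def virtual_winners_iff)
      qed
      have W: "W i x \<longleftrightarrow> i \<in> winners n G x" if "i \<in> {1..n}" for i
      proof -
        have "virtual_winners n G x \<subseteq> {1..n}" by (auto simp: virtual_winners_iff)
        then show ?thesis using V that by (auto simp: W_def winners_def)
      qed
      have "winners n G x \<subseteq> {1..n}" by (auto simp: winners_def virtual_winners_iff)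
      then have "{j \<in> {1..n}. W j x} = winners n G x" using W by auto
      then have "(\<Sum>j\<in>{1..n}. if W j x then 1 else 0 :: real) = card (winners n G x)"
        by (simp add: sum.If_cases Int_def)
      moreover have "real_of_ereal (ironed_virtual_value (G i) (x i)) = g i (x i)"
        if "i \<in> {1..n}" "i \<in> winners n G x" for i
      proof -
        have "0 \<le> ironed_virtual_value (G i) (x i)"
          using that by (auto simp: winners_def virtual_winners_iff)
        then show ?thesis using g[OF that(1)] by (metis max_absorb2 real_of_ereal.simps(1))
      qed
      ultimately have "(\<Sum>i\<in>{1..n}. (x i - g i (x i)) * (if W i x then 1 / (\<Sum>j\<in>{1..n}. if W j x then 1 else 0) else 0))
          = (\<Sum>i=1..n. (x i - real_of_ereal (ironed_virtual_value (G i) (x i))) * allocation n G x i)"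
        using W by (intro sum.cong) (auto simp: allocation_def)
      then show ?thesis by simp
    qed simp
  qed
  finally show ?thesis .
qed

lemma buyers_surplus_eq_AE:
  assumes G: "\<And>i. i \<in> {1..n} \<Longrightarrow> unit_cdf (G i)"
    and h: "h \<in> borel_measurable (\<Pi>\<^sub>M i\<in>{1..n}. interval_measure (G i))"
    and AE: "AE x in (\<Pi>\<^sub>M i\<in>{1..n}. interval_measure (G i)). x \<in> (\<Pi>\<^sub>E i\<in>{1..n}. {0..1}) \<longrightarrow>
      (\<Sum>i=1..n. (x i - real_of_ereal (ironed_virtual_value (G i) (x i))) * allocation n G x i) = h x"
  shows "buyers_surplus n G = (LINT x|(\<Pi>\<^sub>M i\<in>{1..n}. interval_measure (G i)). h x)"
proof -
  have AE': "AE x in (\<Pi>\<^sub>M i\<in>{1..n}. interval_measure (G i)). x \<in> (\<Pi>\<^sub>E i\<in>{1..n}. {0..1})"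
    by (rule AE_signals_bounds) (rule G)
  have "buyers_surplus n G = (LINT x|(\<Pi>\<^sub>M i\<in>{1..n}. interval_measure (G i)).
      indicator (\<Pi>\<^sub>E i\<in>{1..n}. {0..1}) x *
      (\<Sum>i=1..n. (x i - real_of_ereal (ironed_virtual_value (G i) (x i))) * allocation n G x i))"
    by (simp add: buyers_surplus_def set_lebesgue_integral_def)
  also have "\<dots> = (LINT x|(\<Pi>\<^sub>M i\<in>{1..n}. interval_measure (G i)). h x)"
  proof (rule integral_cong_AE[OF measurable_surplus_integrand[OF G] h])
    show "AE x in (\<Pi>\<^sub>M i\<in>{1..n}. interval_measure (G i)).
      indicator (\<Pi>\<^sub>E i\<in>{1..n}. {0..1}) x *
      (\<Sum>i=1..n. (x i - real_of_ereal (ironed_virtual_value (G i) (x i))) * allocation n G x i) = h x"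
      using AE AE' by eventually_elim auto
  qed
  finally show ?thesis .
qed

lemma surplus_sum_eq_0:
  assumes "\<And>i. i \<in> winners n G x \<Longrightarrow> ironed_virtual_value (G i) (x i) = ereal (x i)"
  shows "(\<Sum>i=1..n. (x i - real_of_ereal (ironed_virtual_value (G i) (x i))) * allocation n G x i) = 0"
  using assms by (intro sum.neutral) (auto simp: allocation_def)

text \<open>Tied winners share the object equally, so their shares of the common payoff
  \<open>v\<close> add up to \<open>v\<close>.\<close>

lemma surplus_sum_eq:
  assumes v: "\<And>i. i \<in> winners n G x \<Longrightarrow> x i - real_of_ereal (ironed_virtual_value (G i) (x i)) = v"
    and ne: "winners n G x \<noteq> {}"
  shows "(\<Sum>i=1..n. (x i - real_of_ereal (ironed_virtual_value (G i) (x i))) * allocation n G x i) = v"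
proof -
  have sub: "winners n G x \<subseteq> {1..n}" by (auto simp: winners_def virtual_winners_iff)
  then have "finite (winners n G x)" by (rule finite_subset) simp
  then have card: "card (winners n G x) \<noteq> 0" using ne by simp
  have "(\<Sum>i=1..n. (x i - real_of_ereal (ironed_virtual_value (G i) (x i))) * allocation n G x i)
      = (\<Sum>i\<in>winners n G x. v / card (winners n G x))"
    using v sub by (intro sum.mono_neutral_cong_right) (auto simp: allocation_def)
  then show ?thesis using card by simp
qed

lemma lowest_signal_eq_0:
  assumes "0 < G 0"
  shows "lowest_signal G = 0"
  unfolding lowest_signal_def using assms by (intro cInf_eq_minimum) auto

lemma continuous_at_right_eq:
  fixes f h :: "real \<Rightarrow> real"
  assumes "continuous (at x) h" "x < b" "\<And>y. x \<le> y \<Longrightarrow> y < b \<Longrightarrow> f y = h y"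
  shows "continuous (at_right x) f"
proof -
  have "(h \<longlongrightarrow> h x) (at_right x)"
    using assms(1) unfolding continuous_at by (rule filterlim_mono) (auto intro: at_le)
  moreover have "\<forall>\<^sub>F y in at_right x. h y = f y"
    using assms(2,3) by (auto simp: eventually_at_right intro!: exI[of _ b])
  moreover have "f x = h x" using assms(2,3) by simp
  ultimately show ?thesis
    unfolding continuous_within using Lim_transform_eventually by metis
qed

lemma measure_signal_open_interval:
  assumes G: "unit_cdf G" and lim: "(G \<longlongrightarrow> l) (at_left b)" and "a < b"
  shows "measure (interval_measure G) {a<..<b} = l - G a"
proof -
  interpret real_distribution "interval_measure G" by (rule real_distribution_signal[OF G])
  have "{a<..<b} = {..<b} - {..a}" "{..a} \<subseteq> {..<b}" using \<open>a < b\<close> by auto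
  then show ?thesis
    using finite_measure_Diff[of "{..<b}" "{..a}"] \<open>a < b\<close>
      measure_signal_lessThan[OF G lim] measure_signal_atMost[OF G] by auto
qed

lemma AE_signal_notin:
  assumes G: "unit_cdf G" and "measure (interval_measure G) A = 0" "A \<in> sets borel"
  shows "AE x in interval_measure G. x \<notin> A"
proof -
  interpret real_distribution "interval_measure G" by (rule real_distribution_signal[OF G])
  show ?thesis using assms by (intro AE_not_in) (auto simp: null_sets_def emeasure_eq_measure)
qed

lemma tendsto_at_left_eq:
  fixes f h :: "real \<Rightarrow> real"
  assumes "isCont h b" "a < b" "\<And>y. a < y \<Longrightarrow> y < b \<Longrightarrow> f y = h y"
  shows "(f \<longlongrightarrow> h b) (at_left b)"
proof -
  have "(h \<longlongrightarrow> h b) (at_left b)"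
    using assms(1) unfolding isCont_def by (rule filterlim_mono) (auto intro: at_le)
  moreover have "\<forall>\<^sub>F y in at_left b. h y = f y"
    using assms(2,3) by (auto simp: eventually_at_left intro!: exI[of _ a])
  ultimately show ?thesis using Lim_transform_eventually by metis
qed

subsection \<open>Degenerate and three-point distributions\<close>

context
  fixes p :: real
  assumes p: "0 < p" "p < 1"
begin

lemma unit_cdf_degenerate: "unit_cdf (degenerate_cdf p)"
  unfolding unit_cdf_def
proof (intro conjI allI impI)
  show "mono (degenerate_cdf p)" by (auto simp: mono_def degenerate_cdf_def)
  show "continuous (at_right x) (degenerate_cdf p)" for x
  proof (cases "x < p")
    case True
    then show ?thesis
      by (intro continuous_at_right_eq[of x "\<lambda>_. 0" p]) (auto simp: degenerate_cdf_def)
  next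
    case False
    then show ?thesis
      by (intro continuous_at_right_eq[of x "\<lambda>_. 1" "x + 1"]) (auto simp: degenerate_cdf_def)
  qed
qed (use p in \<open>auto simp: degenerate_cdf_def\<close>)

lemma signal_cdf_degenerate: "signal_cdf p (degenerate_cdf p)"
proof -
  have "((\<lambda>z. 1 - degenerate_cdf p z) has_integral (1 * (p - 0)) + 0) {0..1}"
  proof (rule has_integral_combine[of 0 p 1])
    show "((\<lambda>z. 1 - degenerate_cdf p z) has_integral (1 * (p - 0))) {0..p}"
      by (rule has_integral_spike_finite[where S = "{p}" and f = "\<lambda>_. 1"])
        (use p has_integral_const_real[of "1::real" 0 p] in \<open>auto simp: degenerate_cdf_def\<close>)
    show "((\<lambda>z. 1 - degenerate_cdf p z) has_integral 0) {p..1}"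
      by (rule has_integral_is_0) (auto simp: degenerate_cdf_def)
  qed (use p in auto)
  from has_integral_unique[OF has_integral_signal_tail[OF unit_cdf_degenerate] this]
  show ?thesis using unit_cdf_degenerate by (simp add: signal_cdf_def)
qed

lemma ironed_virtual_value_degenerate: "ironed_virtual_value (degenerate_cdf p) p = ereal p"
proof -
  have "{x \<in> {0..1}. degenerate_cdf p x > 0} = {p..1}"
    using p by (auto simp: degenerate_cdf_def split: if_splits)
  then have low: "lowest_signal (degenerate_cdf p) = p"
    using p by (simp add: lowest_signal_def)
  \<comment> \<open>The supporting line passes through \<open>(0, 0)\<close> and
    \<open>(1, p)\<close>, the points of \<open>Psi\<close> at the two values of this CDF.\<close>
  have "(0, p) \<in> Theta (degenerate_cdf p)"
    by (auto simp: Theta_def Psi_def low degenerate_cdf_def)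
  moreover have "Phi (degenerate_cdf p) p \<le> 0 + p * degenerate_cdf p p"
    using Phi_le_Psi[OF unit_cdf_degenerate, of p p] p by (simp add: Psi_def low degenerate_cdf_def)
  moreover have "Phi (degenerate_cdf p) 0 \<le> 0"
    using Phi_le_Psi[OF unit_cdf_degenerate, of 0 0] p by (simp add: Psi_def low)
  ultimately show ?thesis
    using p by (intro ironed_virtual_value_eqI[OF unit_cdf_degenerate])
      (auto simp: degenerate_cdf_def intro!: bexI[of _ 0])
qed

lemma AE_signal_degenerate: "AE x in interval_measure (degenerate_cdf p). x = p"
proof -
  have "(degenerate_cdf p \<longlongrightarrow> 0) (at_left p)"
    using tendsto_at_left_eq[where h = "\<lambda>_. 0" and b = p and a = "p - 1" and f = "degenerate_cdf p"] by (auto simp: degenerate_cdf_def)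
  from measure_signal_lessThan[OF unit_cdf_degenerate this]
  have "AE x in interval_measure (degenerate_cdf p). x \<notin> {..<p}"
    by (intro AE_signal_notin[OF unit_cdf_degenerate]) auto
  moreover have "AE x in interval_measure (degenerate_cdf p). x \<notin> {p<..}"
    using measure_signal_greaterThan[OF unit_cdf_degenerate, of p]
    by (intro AE_signal_notin[OF unit_cdf_degenerate]) (auto simp: degenerate_cdf_def)
  ultimately show ?thesis by eventually_elim auto
qed

lemma buyers_surplus_degenerate: "buyers_surplus n (\<lambda>_. degenerate_cdf p) = 0"
proof -
  let ?P = "\<Pi>\<^sub>M i\<in>{1..n}. interval_measure (degenerate_cdf p)"
  have "AE x in ?P. \<forall>i\<in>{1..n}. x i = p"
    using real_distribution_signal[OF unit_cdf_degenerate]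
    by (intro AE_finite_allI AE_PiM_component AE_signal_degenerate) (auto simp: real_distribution_def)
  then have "AE x in ?P. (\<Sum>i=1..n. (x i - real_of_ereal (ironed_virtual_value (degenerate_cdf p) (x i)))
      * allocation n (\<lambda>_. degenerate_cdf p) x i) = 0"
  proof eventually_elim
    case (elim x)
    then show ?case by (intro sum.neutral) (simp add: ironed_virtual_value_degenerate)
  qed
  then have "buyers_surplus n (\<lambda>_. degenerate_cdf p) = (LINT x|?P. 0)"
    by (intro buyers_surplus_eq_AE unit_cdf_degenerate) auto
  then show ?thesis by simp
qed

text \<open>The signals are \<open>0\<close>, \<open>(1 + p) / 2\<close> and \<open>1\<close>, the latter two with probabilities \<open>2 t\<close> and
  \<open>t = p / (2 + p)\<close>. The ironed virtual value \<open>(1 + 3 p) / 4\<close> of the middle signal lies between \<open>p\<close>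
  and the signal itself, so a buyer with this distribution outbids buyers with signal \<open>p\<close> and
  keeps a rent.\<close>

definition three_point_cdf :: "real \<Rightarrow> real" where
  "three_point_cdf x = (if x < 0 then 0 else if x < (1 + p) / 2 then 1 - 3 * (p / (2 + p))
     else if x < 1 then 1 - p / (2 + p) else 1)"

lemma three_point_params:
  "0 < p / (2 + p)" "3 * (p / (2 + p)) < 1" "p < (1 + p) / 2" "(1 + p) / 2 < 1"
  using p by (auto simp: field_simps)

lemma unit_cdf_three_point: "unit_cdf three_point_cdf"
  unfolding unit_cdf_def
proof (intro conjI allI impI)
  show "mono three_point_cdf"
    unfolding mono_def three_point_cdf_def using three_point_params p
    by (auto intro!: divide_right_mono)
  show "continuous (at_right x) three_point_cdf" for x
  proof -
    consider "x < 0" | "0 \<le> x" "x < (1 + p) / 2" | "(1 + p) / 2 \<le> x" "x < 1" | "1 \<le> x"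
      by linarith
    then show ?thesis
    proof cases
      case 1
      then show ?thesis
        by (intro continuous_at_right_eq[of x "\<lambda>_. 0" 0]) (auto simp: three_point_cdf_def)
    next
      case 2
      then show ?thesis
        by (intro continuous_at_right_eq[of x "\<lambda>_. 1 - 3 * (p / (2 + p))" "(1 + p) / 2"])
          (auto simp: three_point_cdf_def)
    next
      case 3
      then show ?thesis using p
        by (intro continuous_at_right_eq[of x "\<lambda>_. 1 - p / (2 + p)" 1])
          (auto simp: three_point_cdf_def)
    next
      case 4
      then show ?thesis using p
        by (intro continuous_at_right_eq[of x "\<lambda>_. 1" "x + 1"]) (auto simp: three_point_cdf_def)
    qed
  qed
qed (use p in \<open>auto simp: three_point_cdf_def\<close>)

lemma signal_cdf_three_point: "signal_cdf p three_point_cdf"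
proof -
  let ?m = "(1 + p) / 2" and ?t = "p / (2 + p)"
  have "((\<lambda>z. 1 - three_point_cdf z) has_integral (3 * ?t) * (?m - 0) + ?t * (1 - ?m)) {0..1}"
  proof (rule has_integral_combine[of 0 ?m 1])
    show "((\<lambda>z. 1 - three_point_cdf z) has_integral (3 * ?t) * (?m - 0)) {0..?m}"
      by (rule has_integral_spike_finite[where S = "{?m}" and f = "\<lambda>_. 3 * ?t"])
        (use p three_point_params has_integral_const_real[of "3 * ?t" 0 ?m]
          in \<open>auto simp: three_point_cdf_def mult.commute\<close>)
    show "((\<lambda>z. 1 - three_point_cdf z) has_integral ?t * (1 - ?m)) {?m..1}"
      by (rule has_integral_spike_finite[where S = "{1}" and f = "\<lambda>_. ?t"])
        (use p three_point_params has_integral_const_real[of ?t ?m 1]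
          in \<open>auto simp: three_point_cdf_def mult.commute\<close>)
  qed (use p in auto)
  then have "(LINT x|interval_measure three_point_cdf. x) = (3 * ?t) * (?m - 0) + ?t * (1 - ?m)"
    using has_integral_unique[OF has_integral_signal_tail[OF unit_cdf_three_point]] by blast
  also have "(3 * t) * (?m - 0) + t * (1 - ?m) = t * (2 + p)" for t by (simp add: field_simps)
  also have "?t * (2 + p) = p" using p by simp
  finally show ?thesis using unit_cdf_three_point by (simp add: signal_cdf_def)
qed

lemma Psi_three_point: "x \<in> {0..1} \<Longrightarrow> Psi three_point_cdf x = - x * (1 - three_point_cdf x)"
proof -
  have "0 < three_point_cdf 0" using p three_point_params by (simp add: three_point_cdf_def)
  from lowest_signal_eq_0[of three_point_cdf, OF this] show "x \<in> {0..1} \<Longrightarrow> ?thesis" by (simp add: Psi_def)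
qed

lemma ironed_virtual_value_three_point_0: "ironed_virtual_value three_point_cdf 0 = -\<infinity>"
  by (rule ironed_virtual_value_at_least[OF unit_cdf_three_point]) auto

text \<open>With \<open>t = p / (2 + p)\<close>, \<open>Psi\<close> tends to \<open>- t\<close>
  along the flat piece before 1, where the CDF is \<open>1 - t\<close>; the line from there to
  \<open>(1, 0)\<close> has slope 1. The limit is not attained, so signals \<open>x\<close> close to
  1 are used.\<close>

lemma ironed_virtual_value_three_point_1: "ironed_virtual_value three_point_cdf 1 = ereal 1"
proof (rule ironed_virtual_value_eqI[OF unit_cdf_three_point, where b = "- 1"])
  note P = three_point_params
  let ?m = "(1 + p) / 2" and ?t = "p / (2 + p)"
  have "lowest_signal three_point_cdf = 0"
    using p P by (intro lowest_signal_eq_0) (simp add: three_point_cdf_def)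
  then show "(- 1, 1) \<in> Theta three_point_cdf"
    using unit_slope_in_Theta[OF unit_cdf_three_point] by simp
  show "Phi three_point_cdf 1 \<le> - 1 + 1 * three_point_cdf 1"
    using Phi_le_Psi[OF unit_cdf_three_point, of 1 1] p by (simp add: Psi_three_point three_point_cdf_def)
  fix e :: real assume e: "e > 0"
  define x where "x = max ?m (1 - e)"
  have x: "?m \<le> x" "x < 1" "1 - e \<le> x" using e p by (auto simp: x_def)
  have "0 \<le> ?m" using p by simp
  then have x0: "0 \<le> x" using x(1) by (rule order_trans)
  have Gx: "three_point_cdf x = 1 - ?t" using x x0 by (simp add: three_point_cdf_def)
  have "Phi three_point_cdf x \<le> - x * ?t"
    using Phi_le_Psi[OF unit_cdf_three_point, of x x] x x0 Gx by (simp add: Psi_three_point)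
  also have "\<dots> \<le> - (1 - e) * ?t" using x P(1) by (intro mult_right_mono) auto
  also have "- (1 - e) * t = - 1 + 1 * (1 - t) + e * (1 - (1 - t))" for t by (simp add: algebra_simps)
  finally have "Phi three_point_cdf x \<le> - 1 + 1 * three_point_cdf x + e * (three_point_cdf 1 - three_point_cdf x)"
    unfolding Gx unit_cdf_ge_1[OF unit_cdf_three_point order_refl] .
  moreover have "three_point_cdf x < three_point_cdf 1"
    unfolding Gx unit_cdf_ge_1[OF unit_cdf_three_point order_refl] using P(1) by simp
  moreover have "x \<in> {0..1}" using x x0 by simp
  ultimately show "\<exists>x\<in>{0..1}. three_point_cdf x < three_point_cdf 1 \<and>
      Phi three_point_cdf x \<le> - 1 + 1 * three_point_cdf x + e * (three_point_cdf 1 - three_point_cdf x)"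
    by blast
qed auto

text \<open>Below \<open>m\<close> the CDF is \<open>1 - 3 * t\<close> and \<open>Psi\<close> has
  infimum \<open>- 3 * t * m\<close>; from \<open>m\<close> to 1 the CDF is \<open>1 - t\<close> and
  the infimum is \<open>- t\<close>. The line joining these two points has slope
  \<open>(3 * m - 1) / 2\<close>, which is \<open>c\<close>.\<close>

lemma ironed_virtual_value_three_point_mid:
  "ironed_virtual_value three_point_cdf ((1 + p) / 2) = ereal ((1 + 3 * p) / 4)"
proof -
  note P = three_point_params
  define m t c where "m = (1 + p) / 2" and "t = p / (2 + p)" and "c = (1 + 3 * p) / 4"
  have mt: "0 < t" "3 * t < 1" "0 < m" "m < 1" "c < 1" "c = (3 * m - 1) / 2"
    using P p by (auto simp: m_def t_def c_def)
  have G: "three_point_cdf x = (if x < 0 then 0 else if x < m then 1 - 3 * t else if x < 1 then 1 - t else 1)" for x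
    by (simp add: three_point_cdf_def m_def t_def)
  have key: "- t - c * (1 - t) + c * (1 - 3 * t) = - m * (3 * t)"
    unfolding mt(6) by (simp add: field_simps)
  have "ironed_virtual_value three_point_cdf m = ereal c"
  proof (rule ironed_virtual_value_eqI[OF unit_cdf_three_point, where b = "- t - c * (1 - t)"])
    have "- t - c * (1 - t) + c * three_point_cdf x \<le> - x * (1 - three_point_cdf x)" if x: "0 \<le> x" "x \<le> 1" for x
    proof -
      consider "x < m" | "m \<le> x" "x < 1" | "x = 1" using x by linarith
      then show ?thesis
      proof cases
        case 1
        have "- m * (3 * t) \<le> - x * (3 * t)" using 1 mt by (intro mult_right_mono) auto
        then show ?thesis using 1 x key by (simp add: G)
      next
        case 2
        have "1 * t \<ge> x * t" using 2 mt by (intro mult_right_mono) auto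
        then show ?thesis using 2 x mt by (simp add: G)
      next
        case 3
        have "c * t \<le> 1 * t" using mt by (intro mult_right_mono) auto
        then show ?thesis using 3 mt by (simp add: G algebra_simps)
      qed
    qed
    then show "(- t - c * (1 - t), c) \<in> Theta three_point_cdf"
      by (auto simp: Theta_def Psi_three_point)
    show "m \<in> {0..1}" using mt by simp
    have "Phi three_point_cdf m \<le> - t"
    proof (rule field_le_epsilon)
      fix e :: real assume e: "e > 0"
      \<comment> \<open>This \<open>x\<close> lies on the same flat piece as \<open>m\<close> but
        close to 1, where \<open>Psi\<close> is lowest.\<close>
      define x where "x = max m (1 - e)"
      have x: "m \<le> x" "x < 1" "1 - e \<le> x" "0 \<le> x" using e mt by (auto simp: x_def)
      then have "Phi three_point_cdf m \<le> - x * t"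
        using Phi_le_Psi[OF unit_cdf_three_point, of x m] mt by (simp add: Psi_three_point G)
      also have "\<dots> \<le> - (1 - e) * t" using x mt by (intro mult_right_mono) auto
      also have "\<dots> = - t + e * t" by (simp add: algebra_simps)
      also have "e * t \<le> e" using e mt by (intro mult_left_le) auto
      finally show "Phi three_point_cdf m \<le> - t + e" by simp
    qed
    then show "Phi three_point_cdf m \<le> - t - c * (1 - t) + c * three_point_cdf m"
      using mt by (simp add: G)
    fix e :: real assume e: "e > 0"
    define x where "x = max 0 (m - e / 2)"
    have x: "0 \<le> x" "x < m" "m - e / 2 \<le> x" using e mt by (auto simp: x_def)
    have "Phi three_point_cdf x \<le> - x * (3 * t)"
      using Phi_le_Psi[OF unit_cdf_three_point, of x x] x mt by (simp add: Psi_three_point G)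
    also have "\<dots> \<le> - (m - e / 2) * (3 * t)" using x mt by (intro mult_right_mono) auto
    also have "\<dots> \<le> - m * (3 * t) + e * (2 * t)" using e mt by (simp add: algebra_simps)
    finally have le: "Phi three_point_cdf x \<le> - m * (3 * t) + e * (2 * t)" .
    have Gxm: "three_point_cdf x = 1 - 3 * t" "three_point_cdf m = 1 - t"
      using x mt by (simp_all add: G)
    have "e * ((1 - t) - (1 - 3 * t)) = e * (2 * t)" by simp
    then have "Phi three_point_cdf x \<le> - t - c * (1 - t) + c * three_point_cdf x
        + e * (three_point_cdf m - three_point_cdf x)"
      unfolding Gxm using le key by linarith
    moreover have "three_point_cdf x < three_point_cdf m" "x \<in> {0..1}"
      using x mt by (simp_all add: Gxm)
    ultimately show "\<exists>x\<in>{0..1}. three_point_cdf x < three_point_cdf m \<and>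
        Phi three_point_cdf x \<le> - t - c * (1 - t) + c * three_point_cdf x
        + e * (three_point_cdf m - three_point_cdf x)"
      by blast
  qed
  then show ?thesis by (simp add: m_def c_def)
qed

lemma three_point_left_limits:
  "(three_point_cdf \<longlongrightarrow> 1 - 3 * (p / (2 + p))) (at_left ((1 + p) / 2))"
  "(three_point_cdf \<longlongrightarrow> 1 - p / (2 + p)) (at_left 1)"
proof -
  show "(three_point_cdf \<longlongrightarrow> 1 - 3 * (p / (2 + p))) (at_left ((1 + p) / 2))"
    using p tendsto_at_left_eq[where h = "\<lambda>_. 1 - 3 * (p / (2 + p))" and a = 0 and b = "(1 + p) / 2"
        and f = three_point_cdf]
    by (auto simp: three_point_cdf_def)
  show "(three_point_cdf \<longlongrightarrow> 1 - p / (2 + p)) (at_left 1)"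
    using p tendsto_at_left_eq[where h = "\<lambda>_. 1 - p / (2 + p)" and a = "(1 + p) / 2" and b = 1
        and f = three_point_cdf]
    by (auto simp: three_point_cdf_def)
qed

lemma AE_signal_three_point:
  "AE x in interval_measure three_point_cdf. x \<in> {0, (1 + p) / 2, 1}"
proof -
  note U = unit_cdf_three_point and P = three_point_params
  have "AE x in interval_measure three_point_cdf. x \<notin> {0<..<(1 + p) / 2}"
    using p P measure_signal_open_interval[OF U three_point_left_limits(1), of 0]
    by (intro AE_signal_notin[OF U]) (auto simp: three_point_cdf_def)
  moreover have "AE x in interval_measure three_point_cdf. x \<notin> {(1 + p) / 2<..<1}"
    using p P measure_signal_open_interval[OF U three_point_left_limits(2), of "(1 + p) / 2"]
    by (intro AE_signal_notin[OF U]) (auto simp: three_point_cdf_def)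
  ultimately show ?thesis
    using AE_signal_bounds[OF U] by eventually_elim auto
qed

lemma measure_signal_three_point_mid:
  "measure (interval_measure three_point_cdf) {(1 + p) / 2} = 2 * (p / (2 + p))"
proof -
  note U = unit_cdf_three_point
  interpret real_distribution "interval_measure three_point_cdf" by (rule real_distribution_signal[OF U])
  have "{(1 + p) / 2} = {..(1 + p) / 2} - {..<(1 + p) / 2}" by auto
  moreover have "prob ({..(1 + p) / 2} - {..<(1 + p) / 2}) = prob {..(1 + p) / 2} - prob {..<(1 + p) / 2}"
    by (rule finite_measure_Diff) auto
  ultimately show ?thesis
    using measure_signal_lessThan[OF U three_point_left_limits(1)] measure_signal_atMost[OF U, of "(1 + p) / 2"] p
    by (simp add: three_point_cdf_def)
qed

text \<open>Only the middle signal yields a rent, namely \<open>m - c\<close>: buyer 1 then beats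
  every virtual value \<open>p\<close>. At signal 1, and for winners with signal \<open>p\<close>,
  the virtual value equals the signal.\<close>

lemma buyers_surplus_three_point:
  assumes n: "1 \<le> n"
  shows "buyers_surplus n (\<lambda>i. if i = 1 then three_point_cdf else degenerate_cdf p)
    = p * (1 - p) / (2 * (2 + p))"
proof -
  note U = unit_cdf_three_point and P = three_point_params
  define m c where "m = (1 + p) / 2" and "c = (1 + 3 * p) / 4"
  have mc: "0 < m" "m < 1" "p < m" "p < c" using p by (auto simp: m_def c_def)
  let ?G = "\<lambda>i::nat. if i = 1 then three_point_cdf else degenerate_cdf p"
  let ?P = "\<Pi>\<^sub>M i\<in>{1..n}. interval_measure (?G i)"
  have G: "unit_cdf (?G i)" for i using U unit_cdf_degenerate by simp
  have prob: "prob_space (interval_measure (?G i))" for i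
    using real_distribution_signal[OF G] by (simp add: real_distribution_def)
  have 1: "1 \<in> {1..n}" using n by simp
  note vv = ironed_virtual_value_three_point_0 ironed_virtual_value_three_point_1
    ironed_virtual_value_three_point_mid[folded m_def c_def] ironed_virtual_value_degenerate
  have x1m: "(\<lambda>x. x 1) \<in> measurable ?P (interval_measure (?G 1))"
    by (rule measurable_component_singleton[OF 1])
  have "AE x in ?P. x 1 \<in> {0, m, 1}"
    by (rule AE_PiM_component[OF prob 1]) (use AE_signal_three_point in \<open>simp add: m_def\<close>)
  moreover have "AE x in ?P. \<forall>i\<in>{1..n}. i \<noteq> 1 \<longrightarrow> x i = p"
  proof (intro AE_finite_allI)
    show "AE x in ?P. i \<noteq> 1 \<longrightarrow> x i = p" if i: "i \<in> {1..n}" for i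
      by (rule AE_PiM_component[OF prob i]) (use AE_signal_degenerate in auto)
  qed simp
  ultimately have "AE x in ?P. (\<Sum>i=1..n. (x i - real_of_ereal (ironed_virtual_value (?G i) (x i)))
      * allocation n ?G x i) = (m - c) * indicator {m} (x 1)"
  proof eventually_elim
    case (elim x)
    show ?case
    proof (cases "x 1 = m")
      case True
      have "i = 1" if "i \<in> virtual_winners n ?G x" for i
      proof (rule ccontr)
        assume "i \<noteq> 1"
        have "i \<in> {1..n}" "ironed_virtual_value (?G 1) (x 1) \<le> ironed_virtual_value (?G i) (x i)"
          using that 1 unfolding virtual_winners_iff by blast+
        then have "ereal c \<le> ereal p" using True \<open>i \<noteq> 1\<close> elim(2) vv by (simp del: One_nat_def)
        then show False using mc by simp
      qed
      moreover have "1 \<in> virtual_winners n ?G x"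
        using 1 elim(2) True mc p by (auto simp: virtual_winners_iff vv simp del: One_nat_def)
      ultimately have "winners n ?G x = {1}" by (auto simp: winners_def simp del: One_nat_def)
      then show ?thesis
        using True vv by (subst surplus_sum_eq[where v = "m - c"]) (auto simp del: One_nat_def)
    next
      case False
      have "ironed_virtual_value (?G i) (x i) = ereal (x i)" if "i \<in> winners n ?G x" for i
      proof (cases "i = 1")
        case True
        then have "0 \<le> ironed_virtual_value three_point_cdf (x 1)"
          using that by (auto simp: winners_def virtual_winners_iff simp del: One_nat_def)
        then have "x 1 = 1" using False elim(1) vv(1) by (auto simp del: One_nat_def)
        then show ?thesis using True vv by simp
      next
        case False
        then show ?thesis
          using that elim(2) vv by (auto simp: winners_def virtual_winners_iff simp del: One_nat_def)
      qed
      from surplus_sum_eq_0[OF this] show ?thesis using False by simp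
    qed
  qed
  moreover have "(\<lambda>x. (m - c) * indicator {m} (x 1)) \<in> borel_measurable ?P"
    by (rule measurable_compose[OF x1m]) simp
  ultimately have "buyers_surplus n ?G = (LINT x|?P. (m - c) * indicator {m} (x 1))"
    using G by (intro buyers_surplus_eq_AE) auto
  also have "\<dots> = (LINT y|distr ?P (interval_measure (?G 1)) (\<lambda>x. x 1). (m - c) * indicator {m} y)"
    by (rule integral_distr[symmetric, OF x1m]) simp
  also have "distr ?P (interval_measure (?G 1)) (\<lambda>x. x 1) = interval_measure (?G 1)"
    by (rule distr_PiM_component[OF prob 1])
  also have "(LINT y|interval_measure (?G 1). (m - c) * indicator {m} y) = (m - c) * (2 * (p / (2 + p)))"
    using measure_signal_three_point_mid by (simp add: m_def)
  also have "\<dots> = p * (1 - p) / (2 * (2 + p))" using p by (simp add: m_def c_def field_simps)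
  finally show ?thesis .
qed

end

subsection \<open>Truncated Pareto distributions\<close>

text \<open>The support is \<open>{0} \<union> [t / q, 1]\<close>, with an atom of mass \<open>1 - q\<close> at \<open>0\<close> and one of mass \<open>t\<close>
  at \<open>1\<close>. The revenue from every posted price in \<open>[t / q, 1]\<close> is \<open>t\<close>, so the virtual value
  vanishes on \<open>(t / q, 1)\<close>.\<close>

definition truncated_pareto :: "real \<Rightarrow> real \<Rightarrow> real \<Rightarrow> real" where
  "truncated_pareto t q z =
     (if z < 0 then 0 else if 1 \<le> z then 1 else if q * z \<le> t then 1 - q else 1 - t / z)"

lemma tail_truncated_pareto:
  assumes "0 < t" "t < q" "0 \<le> z" "z < 1"
  shows "z \<le> t / q \<Longrightarrow> 1 - truncated_pareto t q z = q"
    and "t / q \<le> z \<Longrightarrow> 1 - truncated_pareto t q z = t / z"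
  using assms by (auto simp: truncated_pareto_def field_simps)

context
  fixes t q :: real
  assumes tq: "0 < t" "t < q" "q < 1"
begin

lemma pareto_threshold: "0 < t / q" "t / q < 1"
  using tq by auto

lemma unit_cdf_truncated_pareto: "unit_cdf (truncated_pareto t q)"
  unfolding unit_cdf_def
proof (intro conjI allI impI)
  show "mono (truncated_pareto t q)"
  proof (rule monoI)
    fix x y :: real assume xy: "x \<le> y"
    consider "x < 0" | "0 \<le> x" "1 \<le> y" | "0 \<le> x" "y < 1" by linarith
    then show "truncated_pareto t q x \<le> truncated_pareto t q y"
    proof cases
      case 3
      have "1 - truncated_pareto t q y \<le> 1 - truncated_pareto t q x"
      proof (cases "y \<le> t / q")
        case True
        then show ?thesis using 3 xy tq by (simp add: tail_truncated_pareto)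
      next
        case y: False
        then have y0: "0 < y" using pareto_threshold by linarith
        show ?thesis
        proof (cases "x \<le> t / q")
          case True
          have "t / y \<le> q" using y y0 tq by (simp add: field_simps)
          then show ?thesis using True y 3 xy tq by (simp add: tail_truncated_pareto)
        next
          case False
          then have "0 < x" using pareto_threshold by linarith
          then have "t / y \<le> t / x" using xy tq by (intro divide_left_mono) auto
          then show ?thesis using False y 3 xy tq by (simp add: tail_truncated_pareto)
        qed
      qed
      then show ?thesis by simp
    next
      case 2
      then show ?thesis using tq by (auto simp: truncated_pareto_def)
    next
      case 1
      have "t / y \<le> 1" if "\<not> q * y \<le> t" "0 \<le> y"
      proof -
        have "0 < y" using that tq by (cases "y = 0") auto
        moreover have "q * y \<le> 1 * y" using tq that by (intro mult_right_mono) auto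
        ultimately have "t \<le> y" using that(1) by linarith
        then show ?thesis using \<open>0 < y\<close> by simp
      qed
      then show ?thesis using 1 tq by (auto simp: truncated_pareto_def)
    qed
  qed
  show "continuous (at_right x) (truncated_pareto t q)" for x
  proof -
    consider "x < 0" | "0 \<le> x" "x < t / q" | "t / q \<le> x" "x < 1" | "1 \<le> x"
      by linarith
    then show ?thesis
    proof cases
      case 1
      then show ?thesis
        by (intro continuous_at_right_eq[of x "\<lambda>_. 0" 0]) (auto simp: truncated_pareto_def)
    next
      case 2
      have "truncated_pareto t q y = 1 - q" if "x \<le> y" "y < t / q" for y
        using tail_truncated_pareto(1)[of t q y] tq 2 that pareto_threshold by simp
      then show ?thesis using 2
        by (intro continuous_at_right_eq[of x "\<lambda>_. 1 - q" "t / q"]) auto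
    next
      case 3
      have "truncated_pareto t q y = 1 - t / y" if "x \<le> y" "y < 1" for y
        using tail_truncated_pareto(2)[of t q y] tq 3 that pareto_threshold by simp
      moreover have "x \<noteq> 0" using 3 pareto_threshold by auto
      ultimately show ?thesis using 3
        by (intro continuous_at_right_eq[of x "\<lambda>z. 1 - t / z" 1] continuous_intros) auto
    next
      case 4
      then show ?thesis
        by (intro continuous_at_right_eq[of x "\<lambda>_. 1" "x + 1"]) (auto simp: truncated_pareto_def)
    qed
  qed
qed (auto simp: truncated_pareto_def)

lemma mean_truncated_pareto:
  "(LINT x|interval_measure (truncated_pareto t q). x) = t * (1 + ln (q / t))"
proof -
  let ?s = "t / q"
  have "((\<lambda>z. 1 - truncated_pareto t q z) has_integral q * (?s - 0) + (t * ln 1 - t * ln ?s)) {0..1}"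
  proof (rule has_integral_combine[of 0 ?s 1])
    show "((\<lambda>z. 1 - truncated_pareto t q z) has_integral q * (?s - 0)) {0..?s}"
    proof (rule has_integral_eq)
      show "((\<lambda>_. q) has_integral q * (?s - 0)) {0..?s}"
        using has_integral_const_real[of q 0 ?s] pareto_threshold by (simp add: mult.commute)
      show "q = 1 - truncated_pareto t q z" if "z \<in> {0..?s}" for z
        using that tail_truncated_pareto(1)[of t q z] tq pareto_threshold by simp
    qed
    have "((\<lambda>z. t / z) has_integral t * ln 1 - t * ln ?s) {?s..1}"
    proof (rule fundamental_theorem_of_calculus)
      show "((\<lambda>z. t * ln z) has_vector_derivative t / z) (at z within {?s..1})" if "z \<in> {?s..1}" for z
      proof -
        have "0 < z" using that pareto_threshold by auto
        then show ?thesis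
          by (auto intro!: derivative_eq_intros simp: has_real_derivative_iff_has_vector_derivative[symmetric])
      qed
    qed (use pareto_threshold in simp)
    then show "((\<lambda>z. 1 - truncated_pareto t q z) has_integral t * ln 1 - t * ln ?s) {?s..1}"
    proof (rule has_integral_spike_finite[rotated 2])
      show "1 - truncated_pareto t q z = t / z" if "z \<in> {?s..1} - {1}" for z
      proof -
        have "0 \<le> z" "?s \<le> z" "z < 1" using that pareto_threshold by (auto simp: order.strict_iff_order)
        then show ?thesis using tail_truncated_pareto(2)[of t q z] tq by simp
      qed
    qed simp
  qed (use pareto_threshold in auto)
  from has_integral_unique[OF has_integral_signal_tail[OF unit_cdf_truncated_pareto] this]
  show ?thesis using tq by (simp add: ln_div algebra_simps)
qed

lemma truncated_pareto_left_limit: "(truncated_pareto t q \<longlongrightarrow> 1 - t) (at_left 1)"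
proof -
  have "truncated_pareto t q y = 1 - t / y" if "t / q < y" "y < 1" for y
    using tail_truncated_pareto(2)[of t q y] tq pareto_threshold that by simp
  then show ?thesis
    using tendsto_at_left_eq[where h = "\<lambda>z. 1 - t / z" and a = "t / q" and b = 1 and f = "truncated_pareto t q"]
      pareto_threshold by (simp add: continuous_intros)
qed

text \<open>The threshold \<open>t / q\<close> is excluded on purpose: the CDF still has its least
  value there, so the virtual value is minus infinity instead of 0.\<close>

lemma AE_signal_truncated_pareto:
  "AE x in interval_measure (truncated_pareto t q). x \<in> {0} \<union> {t / q<..1}"
proof -
  note U = unit_cdf_truncated_pareto
  have "truncated_pareto t q (t / q) = truncated_pareto t q 0"
    using tail_truncated_pareto(1)[of t q] tq pareto_threshold by (smt (verit) order_refl)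
  then have "measure (interval_measure (truncated_pareto t q)) {0<..t / q} = 0"
    using measure_interval_measure_Ioc[of 0 "t / q" "truncated_pareto t q"] pareto_threshold
      unit_cdf_mono[OF U] unit_cdf_right_cont[OF U] by auto
  then have "AE x in interval_measure (truncated_pareto t q). x \<notin> {0<..t / q}"
    by (intro AE_signal_notin[OF U]) auto
  then show ?thesis
    using AE_signal_bounds[OF U] by eventually_elim auto
qed

lemma Psi_truncated_pareto:
  assumes "0 \<le> x"
  shows "Psi (truncated_pareto t q) x = - x * (1 - truncated_pareto t q x)"
proof -
  have "0 < truncated_pareto t q 0" using tq by (simp add: truncated_pareto_def)
  from lowest_signal_eq_0[of "truncated_pareto t q", OF this] show ?thesis
    using assms by (simp add: Psi_def)
qed

lemma Psi_truncated_pareto_mid: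
  assumes "t / q \<le> x" "x < 1"
  shows "Psi (truncated_pareto t q) x = - t"
proof -
  have "0 < x" using assms pareto_threshold by linarith
  then show ?thesis
    using Psi_truncated_pareto[of x] tail_truncated_pareto(2)[of t q x] assms tq by simp
qed

lemma ironed_virtual_value_truncated_pareto_0:
  "ironed_virtual_value (truncated_pareto t q) 0 = -\<infinity>"
  by (rule ironed_virtual_value_at_least[OF unit_cdf_truncated_pareto]) auto

text \<open>No price earns more than \<open>t\<close>, so the horizontal line at \<open>- t\<close>
  supports \<open>Psi\<close>. It touches at \<open>y\<close> and already at \<open>t / q\<close>,
  where the CDF is smaller, so the left slope is 0.\<close>

lemma ironed_virtual_value_truncated_pareto_mid:
  assumes y: "t / q < y" "y < 1"
  shows "ironed_virtual_value (truncated_pareto t q) y = 0"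
proof -
  note U = unit_cdf_truncated_pareto
  let ?G = "truncated_pareto t q" and ?s = "t / q"
  have y0: "0 < y" using y pareto_threshold by linarith
  have "ironed_virtual_value ?G y = ereal 0"
  proof (rule ironed_virtual_value_eqI[OF U, where b = "- t"])
    have "- t + 0 * ?G x \<le> Psi ?G x" if "x \<in> {0..1}" for x
    proof -
      have "x \<le> 1" using that by simp
      then consider "x \<le> ?s" | "?s \<le> x" "x < 1" | "x = 1" by linarith
      then show ?thesis
      proof cases
        case 1
        then have "x * q \<le> t" using tq by (simp add: field_simps)
        then show ?thesis
          using 1 that tail_truncated_pareto(1)[of t q x] tq pareto_threshold
          by (simp add: Psi_truncated_pareto)
      next
        case 2
        then show ?thesis using Psi_truncated_pareto_mid by simp
      next
        case 3
        then show ?thesis using tq unit_cdf_ge_1[OF U, of 1] by (simp add: Psi_truncated_pareto)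
      qed
    qed
    then show "(- t, 0) \<in> Theta ?G" by (simp add: Theta_def)
    show "y \<in> {0..1}" using y y0 by simp
    show "Phi ?G y \<le> - t + 0 * ?G y"
      using Phi_le_Psi[OF U, of y y] Psi_truncated_pareto_mid[of y] y y0 by simp
    fix e :: real assume e: "e > 0"
    have "1 - ?G ?s = q" using tail_truncated_pareto(1)[of t q ?s] tq pareto_threshold by simp
    moreover have "1 - ?G y = t / y" using tail_truncated_pareto(2)[of t q y] tq y y0 by simp
    moreover have "t / y < q" using y y0 tq by (simp add: field_simps)
    ultimately have less: "?G ?s < ?G y" by linarith
    have "Phi ?G ?s \<le> - t"
      using Phi_le_Psi[OF U, of ?s ?s] Psi_truncated_pareto_mid[of ?s] pareto_threshold by simp
    also have "\<dots> \<le> - t + 0 * ?G ?s + e * (?G y - ?G ?s)" using less e by simp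
    finally show "\<exists>x\<in>{0..1}. ?G x < ?G y \<and> Phi ?G x \<le> - t + 0 * ?G x + e * (?G y - ?G x)"
      using less pareto_threshold by (intro bexI[of _ ?s]) auto
  qed
  then show ?thesis by (simp add: zero_ereal_def)
qed

text \<open>Just before 1, \<open>Psi\<close> equals \<open>- t\<close> and the CDF is close to
  \<open>1 - t\<close>, so the slope towards \<open>(1, 0)\<close> tends to 1.\<close>

lemma ironed_virtual_value_truncated_pareto_1:
  "ironed_virtual_value (truncated_pareto t q) 1 = ereal 1"
proof (rule ironed_virtual_value_eqI[OF unit_cdf_truncated_pareto, where b = "- 1"])
  note U = unit_cdf_truncated_pareto
  let ?G = "truncated_pareto t q" and ?s = "t / q"
  have G1: "?G 1 = 1" by (simp add: truncated_pareto_def)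
  have "lowest_signal ?G = 0"
    using tq by (intro lowest_signal_eq_0) (simp add: truncated_pareto_def)
  then show "(- 1, 1) \<in> Theta ?G"
    using unit_slope_in_Theta[OF U] by simp
  show "Phi ?G 1 \<le> - 1 + 1 * ?G 1"
    using Phi_le_Psi[OF U, of 1 1] G1 by (simp add: Psi_truncated_pareto)
  fix e :: real assume e: "e > 0"
  define x where "x = max ?s (1 - e)"
  have x: "?s \<le> x" "x < 1" "1 - e \<le> x" using e pareto_threshold by (auto simp: x_def)
  then have x0: "0 < x" using pareto_threshold by linarith
  have Gx: "1 - ?G x = t / x" using tail_truncated_pareto(2)[of t q x] tq x x0 by simp
  have "Phi ?G x \<le> - t"
    using Phi_le_Psi[OF U, of x x] Psi_truncated_pareto_mid[of x] x x0 by simp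
  also have "\<dots> \<le> - (t / x) * (1 - e)"
  proof -
    have "(1 - e) * t \<le> x * t" using x tq by (intro mult_right_mono) auto
    then have "(1 - e) * t / x \<le> t" using x0 by (simp add: pos_divide_le_eq mult.commute)
    then show ?thesis by (simp add: mult.commute)
  qed
  also have "\<dots> = - (1 - ?G x) * (1 - e)" unfolding Gx ..
  also have "\<dots> = - 1 + 1 * ?G x + e * (?G 1 - ?G x)"
    unfolding G1 by (simp add: algebra_simps)
  finally have "Phi ?G x \<le> - 1 + 1 * ?G x + e * (?G 1 - ?G x)" .
  moreover have "?G x < ?G 1" using Gx G1 x0 tq by (smt (verit) divide_pos_pos)
  moreover have "x \<in> {0..1}" using x x0 by simp
  ultimately show "\<exists>x\<in>{0..1}. ?G x < ?G 1 \<and> Phi ?G x \<le> - 1 + 1 * ?G x + e * (?G 1 - ?G x)"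
    by blast
qed auto

end

text \<open>As long as no signal is 1, every positive signal has virtual value 0; the tie is broken
  in favor of the highest signal, and the winner keeps all of it. If some signal is 1, the winner
  has virtual value 1 and keeps nothing. So the surplus is the expected maximum minus the
  probability that some signal is 1.\<close>

lemma buyers_surplus_truncated_pareto:
  fixes t q :: "nat \<Rightarrow> real"
  assumes tq: "\<And>i. 0 < t i" "\<And>i. t i < q i" "\<And>i. q i < 1"
  defines "G \<equiv> \<lambda>i. truncated_pareto (t i) (q i)"
  shows "buyers_surplus 2 G =
    (LINT x|(\<Pi>\<^sub>M i\<in>{1..2}. interval_measure (G i)). max (x 1) (x 2)) - (1 - (1 - t 1) * (1 - t 2))"
proof -
  note One_nat_def [simp del]
  let ?P = "\<Pi>\<^sub>M i\<in>{1..2::nat}. interval_measure (G i)"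
  have U: "unit_cdf (G i)" for i unfolding G_def by (rule unit_cdf_truncated_pareto[OF tq])
  interpret real_distribution "interval_measure (G i)" for i
    by (rule real_distribution_signal[OF U])
  interpret PP: product_prob_space "\<lambda>i. interval_measure (G i)" "{1..2}"
    by (intro product_prob_spaceI) (rule prob_space_axioms)
  let ?B = "{x \<in> extensional {1..2}. \<not> (x 1 \<in> {..<1} \<and> x 2 \<in> {..<1::real})}"
  have 12: "i = 1 \<or> i = 2" if "i \<in> {1..2}" for i :: nat using that by auto
  have sp: "space ?P = extensional {1..2}" unfolding space_PiM by (auto simp: PiE_def)
  have "{x \<in> space ?P. x 1 < 1 \<and> x 2 < 1} \<in> sets ?P" by measurable
  moreover have B_eq: "?B = space ?P - {x \<in> space ?P. x 1 < 1 \<and> x 2 < 1}" using sp by auto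
  ultimately have B: "?B \<in> sets ?P" by auto
  have m: "(\<lambda>x. max (x 1) (x 2)) \<in> borel_measurable ?P" by measurable
  have AEx: "AE x in ?P. \<forall>i\<in>{1..2}. x i \<in> {0} \<union> {t i / q i<..1}"
  proof (intro AE_finite_allI)
    show "AE x in ?P. x i \<in> {0} \<union> {t i / q i<..1}" if i: "i \<in> {1..2}" for i
      by (rule AE_PiM_component[OF prob_space_axioms i])
        (unfold G_def, rule AE_signal_truncated_pareto[OF tq])
  qed simp
  have "buyers_surplus 2 G = (LINT x|?P. max (x 1) (x 2) - indicator ?B x)"
  proof (rule buyers_surplus_eq_AE[OF U])
    show "(\<lambda>x. max (x 1) (x 2) - indicator ?B x) \<in> borel_measurable ?P"
      using m B by (intro borel_measurable_diff borel_measurable_indicator)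
    show "AE x in ?P. x \<in> (\<Pi>\<^sub>E i\<in>{1..2}. {0..1}) \<longrightarrow>
      (\<Sum>i=1..2. (x i - real_of_ereal (ironed_virtual_value (G i) (x i))) * allocation 2 G x i)
        = max (x 1) (x 2) - indicator ?B x"
      using AEx
    proof (eventually_elim, intro impI)
      fix x :: "nat \<Rightarrow> real"
      assume x: "\<forall>i\<in>{1..2}. x i \<in> {0} \<union> {t i / q i<..1}" and cube: "x \<in> (\<Pi>\<^sub>E i\<in>{1..2}. {0..1})"
      have vv: "ironed_virtual_value (G i) 0 = -\<infinity>" "ironed_virtual_value (G i) 1 = ereal 1"
        "t i / q i < y \<Longrightarrow> y < 1 \<Longrightarrow> ironed_virtual_value (G i) y = 0" for i y
        unfolding G_def using ironed_virtual_value_truncated_pareto_0[OF tq]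
          ironed_virtual_value_truncated_pareto_1[OF tq] ironed_virtual_value_truncated_pareto_mid[OF tq]
        by auto
      have pos: "0 < t i / q i" "t i / q i < 1" for i using pareto_threshold[OF tq] by auto
      have cases: "x i = 0 \<or> t i / q i < x i \<and> x i < 1 \<or> x i = 1" if "i \<in> {1..2}" for i
        using x that by force
      have le1: "x i \<le> 1" if "i \<in> {1..2}" for i using cases[OF that] by auto
      have ge0: "0 \<le> x i" if "i \<in> {1..2}" for i using cases[OF that] pos[of i] by linarith
      have ext: "x \<in> extensional {1..2}" using cube by (simp add: PiE_def)
      obtain i0 :: nat where i0: "i0 \<in> {1..2}" "max (x 1) (x 2) = x i0"
        by (cases "x 1 \<le> x 2") (auto intro: that[of 1] that[of 2])
      have top: "x i \<le> x i0" if "i \<in> {1..2}" for i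
        unfolding i0(2)[symmetric] using 12[OF that] by auto
      have le_vv: "ironed_virtual_value (G i0) (x i0) \<le> ironed_virtual_value (G i) (x i)"
        "i \<in> {1..2}" "0 \<le> ironed_virtual_value (G i) (x i)"
        if "i \<in> winners 2 G x" for i
        using that i0(1) by (auto simp: winners_def virtual_winners_iff)
      consider "x i0 = 0" | "t i0 / q i0 < x i0" "x i0 < 1" | "x i0 = 1"
        using cases[OF i0(1)] by blast
      then show "(\<Sum>i=1..2. (x i - real_of_ereal (ironed_virtual_value (G i) (x i))) * allocation 2 G x i)
        = max (x 1) (x 2) - indicator ?B x"
      proof cases
        case 1
        have "False" if "i \<in> winners 2 G x" for i
        proof -
          have "x i = 0" using top[OF le_vv(2)[OF that]] ge0[OF le_vv(2)[OF that]] 1 by simp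
          then show False using le_vv(3)[OF that] vv(1)[of i] by simp
        qed
        then have "(\<Sum>i=1..2. (x i - real_of_ereal (ironed_virtual_value (G i) (x i))) * allocation 2 G x i) = 0"
          by (intro surplus_sum_eq_0) blast
        moreover have "x 1 < 1" "x 2 < 1" using top[of 1] top[of 2] 1 by auto
        ultimately show ?thesis using 1 i0(2) by simp
      next
        case 2
        have lt1: "x i < 1" if "i \<in> {1..2}" for i using top[OF that] 2 by simp
        have vv0: "ironed_virtual_value (G i0) (x i0) = 0" using vv(3) 2 by simp
        have "ironed_virtual_value (G i) (x i) \<le> 0" if "i \<in> {1..2}" for i
          using cases[OF that] lt1[OF that] vv by auto
        then have i0v: "i0 \<in> virtual_winners 2 G x"
          using i0(1) vv0 by (auto simp: virtual_winners_iff)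
        then have "i0 \<in> winners 2 G x"
          using top by (auto simp: winners_def virtual_winners_iff)
        moreover have "x i - real_of_ereal (ironed_virtual_value (G i) (x i)) = x i0"
          if "i \<in> winners 2 G x" for i
        proof -
          have "x i0 \<le> x i" using that i0v by (auto simp: winners_def)
          then have eq: "x i = x i0" using top[OF le_vv(2)[OF that]] by simp
          then have "x i \<noteq> 0" "x i \<noteq> 1" using 2 pos[of i0] by auto
          then have "ironed_virtual_value (G i) (x i) = 0"
            using cases[OF le_vv(2)[OF that]] vv(3) by auto
          then show ?thesis using eq by simp
        qed
        ultimately have "(\<Sum>i=1..2. (x i - real_of_ereal (ironed_virtual_value (G i) (x i))) * allocation 2 G x i) = x i0"
          by (intro surplus_sum_eq) auto
        then show ?thesis using i0(2) lt1[of 1] lt1[of 2] by simp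
      next
        case 3
        have "ironed_virtual_value (G i) (x i) = ereal (x i)" if "i \<in> winners 2 G x" for i
        proof -
          have "ereal 1 \<le> ironed_virtual_value (G i) (x i)"
            using le_vv(1)[OF that] 3 vv(2)[of i0] by simp
          then have "x i = 1"
            using cases[OF le_vv(2)[OF that]] vv(1)[of i] vv(3)[of i "x i"] by auto
          then show ?thesis using vv(2) by simp
        qed
        then have "(\<Sum>i=1..2. (x i - real_of_ereal (ironed_virtual_value (G i) (x i))) * allocation 2 G x i) = 0"
          by (rule surplus_sum_eq_0)
        moreover have "x 1 = 1 \<or> x 2 = 1" using 3 12[OF i0(1)] by auto
        then have "x \<in> ?B" using ext by auto
        ultimately show ?thesis using 3 i0(2) by simp
      qed
    qed
  qed
  also have "\<dots> = (LINT x|?P. max (x 1) (x 2)) - (LINT x|?P. indicator ?B x)"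
  proof (rule Bochner_Integration.integral_diff)
    have "AE x in ?P. norm (max (x 1) (x 2)) \<le> 1"
      using AE_signals_bounds[of 2 G, OF U] unfolding PiE_two by eventually_elim auto
    then show "integrable ?P (\<lambda>x. max (x 1) (x 2))"
      by (rule PP.P.integrable_const_bound[OF _ m])
    show "integrable ?P (indicator ?B :: _ \<Rightarrow> real)"
      using B by (intro integrable_real_indicator) (auto simp: PP.P.emeasure_eq_measure)
  qed
  also have "(LINT x|?P. indicator ?B x) = measure ?P ?B"
    using sets.sets_into_space[OF B] by (simp add: Int_absorb2)
  also have "\<dots> = 1 - (1 - t 1) * (1 - t 2)"
  proof -
    have "measure (interval_measure (G i)) {..<1} = 1 - t i" for i
      unfolding G_def
      by (rule measure_signal_lessThan[OF unit_cdf_truncated_pareto[OF tq] truncated_pareto_left_limit[OF tq]])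
    then show ?thesis using measure_two_compl_box[of G "{..<1}" "{..<1}", OF U] by simp
  qed
  finally show ?thesis .
qed

subsection \<open>The surplus of two truncated Pareto distributions\<close>

text \<open>Below both thresholds the product is \<open>q1 * q2\<close>, between them
  \<open>t1 * q2 / z\<close>, above both \<open>t1 * t2 / z\<^sup>2\<close>. The first piece has
  length \<open>t1 / q1\<close>, so \<open>q1\<close> cancels except in the logarithm.\<close>

lemma has_integral_product_of_pareto_tails:
  assumes t: "0 < t1" "0 < t2" and q: "t1 < q1" "t2 < q2" and s: "t1 / q1 < t2 / q2"
  shows "((\<lambda>z. (1 - truncated_pareto t1 q1 z) * (1 - truncated_pareto t2 q2 z)) has_integral
    t1 * q2 + t1 * q2 * (ln (t2 / q2) - ln (t1 / q1)) + (t1 * q2 - t1 * t2)) {0..1}"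
proof -
  let ?f = "\<lambda>z. (1 - truncated_pareto t1 q1 z) * (1 - truncated_pareto t2 q2 z)"
  let ?s = "t1 / q1" and ?r = "t2 / q2"
  have sr: "0 < ?s" "?s < ?r" "?r < 1" "0 < q1" "0 < q2" using assms by auto
  note tail = tail_truncated_pareto[OF t(1) q(1)] tail_truncated_pareto[OF t(2) q(2)]
  have 1: "(?f has_integral t1 * q2) {0..?s}"
  proof (rule has_integral_eq)
    show "((\<lambda>_. q1 * q2) has_integral t1 * q2) {0..?s}"
      using has_integral_const_real[of "q1 * q2" 0 ?s] sr by (simp add: mult.commute)
    show "q1 * q2 = ?f z" if "z \<in> {0..?s}" for z using that tail sr by simp
  qed
  have 2: "(?f has_integral t1 * q2 * ln ?r - t1 * q2 * ln ?s) {?s..?r}"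
  proof (rule has_integral_eq)
    show "((\<lambda>z. t1 * q2 / z) has_integral t1 * q2 * ln ?r - t1 * q2 * ln ?s) {?s..?r}"
    proof (rule fundamental_theorem_of_calculus)
      show "((\<lambda>z. t1 * q2 * ln z) has_vector_derivative t1 * q2 / z) (at z within {?s..?r})"
        if "z \<in> {?s..?r}" for z
      proof -
        have "0 < z" using that sr(1) by auto
        then show ?thesis
          by (auto intro!: derivative_eq_intros simp: has_real_derivative_iff_has_vector_derivative[symmetric])
      qed
    qed (use sr in simp)
    show "t1 * q2 / z = ?f z" if "z \<in> {?s..?r}" for z
    proof -
      have z: "?s \<le> z" "z \<le> ?r" using that by auto
      moreover have "0 \<le> z" "z < 1"
        using z sr by (meson less_imp_le order_trans, meson order.strict_trans1)
      ultimately show ?thesis using tail(2,3) by simp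
    qed
  qed
  have "((\<lambda>z. t1 * t2 / z\<^sup>2) has_integral - (t1 * t2 / 1) - - (t1 * t2 / ?r)) {?r..1}"
  proof (rule fundamental_theorem_of_calculus)
    show "((\<lambda>z. - (t1 * t2 / z)) has_vector_derivative t1 * t2 / z\<^sup>2) (at z within {?r..1})"
      if "z \<in> {?r..1}" for z
    proof -
      have "0 < z" using that sr by auto
      then show ?thesis
        by (auto intro!: derivative_eq_intros
            simp: has_real_derivative_iff_has_vector_derivative[symmetric] power2_eq_square)
    qed
  qed (use sr in simp)
  then have 3: "(?f has_integral - (t1 * t2 / 1) - - (t1 * t2 / ?r)) {?r..1}"
  proof (rule has_integral_spike_finite[rotated 2])
    show "?f z = t1 * t2 / z\<^sup>2" if "z \<in> {?r..1} - {1}" for z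
    proof -
      have "0 \<le> z" "?r \<le> z" "z < 1" "?s \<le> z" using that sr by (auto simp: order.strict_iff_order)
      then show ?thesis using tail(2,4) by (simp add: power2_eq_square)
    qed
  qed simp
  have "(?f has_integral t1 * q2 + (t1 * q2 * ln ?r - t1 * q2 * ln ?s)) {0..?r}"
    using sr by (intro has_integral_combine[OF _ _ 1 2]) auto
  then have "(?f has_integral t1 * q2 + (t1 * q2 * ln ?r - t1 * q2 * ln ?s)
      + (- (t1 * t2 / 1) - - (t1 * t2 / ?r))) {0..1}"
    using sr by (intro has_integral_combine[OF _ _ _ 3]) auto
  then show ?thesis using t by (simp add: algebra_simps)
qed

text \<open>The values of \<open>q1\<close> and \<open>q2\<close> solve
  \<open>t * (1 + ln (q / t)) = p\<close>, the mean condition. Then \<open>ln (t1 / q1)\<close> is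
  \<open>1 - p / t1\<close>, so \<open>q1\<close> drops out and the surplus is affine in
  \<open>t1\<close>. The smaller mass at 1 has the lower threshold, which settles the order required
  by \<open>has_integral_product_of_pareto_tails\<close>.\<close>

lemma asymmetric_pareto_surplus:
  assumes t: "0 < t1" "t1 < t2" "t2 < p"
    and q: "q1 = t1 * exp (p / t1 - 1)" "q2 = t2 * exp (p / t2 - 1)" "q1 < 1" "q2 < 1"
  defines "G \<equiv> \<lambda>i::nat. if i = 1 then truncated_pareto t1 q1 else truncated_pareto t2 q2"
  shows "information_structure 2 p G" and "asymmetric 2 G"
    and "buyers_surplus 2 G = 2 * p - t1 - t2 + 2 * t1 * t2 - q2 * (2 * t1 + p - p * t1 / t2)"
proof -
  define T Q where "T i = (if i = 1 then t1 else t2)" and "Q i = (if i = 1 then q1 else q2)" for i :: nat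
  have G_eq: "G = (\<lambda>i. truncated_pareto (T i) (Q i))" by (auto simp: G_def T_def Q_def)
  have tq: "t1 < q1" "t2 < q2" using t unfolding q by (auto simp: field_simps)
  have TQ: "0 < T i" "T i < Q i" "Q i < 1" for i using t q(3,4) tq by (auto simp: T_def Q_def)
  have ln: "ln (q1 / t1) = p / t1 - 1" "ln (q2 / t2) = p / t2 - 1" using t unfolding q by auto
  have mean1: "(LINT x|interval_measure (truncated_pareto t1 q1). x) = p"
    using mean_truncated_pareto[of t1 q1] t tq q(3) ln by (simp add: field_simps)
  have mean2: "(LINT x|interval_measure (truncated_pareto t2 q2). x) = p"
    using mean_truncated_pareto[of t2 q2] t tq q(4) ln by (simp add: field_simps)
  have U1: "unit_cdf (truncated_pareto t1 q1)" and U2: "unit_cdf (truncated_pareto t2 q2)"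
    using unit_cdf_truncated_pareto t tq q(3,4) by auto
  show "information_structure 2 p G"
    using U1 U2 mean1 mean2 by (simp add: information_structure_def signal_cdf_def G_def)
  have s: "t1 / q1 < t2 / q2"
  proof -
    have "t1 / q1 = exp (1 - p / t1)" "t2 / q2 = exp (1 - p / t2)"
      using t unfolding q by (auto simp: exp_diff)
    moreover have "p / t2 < p / t1" using t by (intro divide_strict_left_mono) auto
    ultimately show ?thesis by simp
  qed
  have "truncated_pareto t1 q1 \<noteq> truncated_pareto t2 q2"
  proof
    assume eq: "truncated_pareto t1 q1 = truncated_pareto t2 q2"
    let ?z = "t2 / q2"
    have z: "0 < ?z" "?z < 1" using t tq by auto
    have "1 - truncated_pareto t1 q1 ?z = t1 / ?z"
      using tail_truncated_pareto(2)[of t1 q1 ?z] t tq s z by simp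
    moreover have "1 - truncated_pareto t2 q2 ?z = t2 / ?z"
      using tail_truncated_pareto(2)[of t2 q2 ?z] t tq z by simp
    ultimately have "t1 / ?z = t2 / ?z" unfolding eq by simp
    then have "t1 = t2" using z(1) by (metis divide_cancel_right less_irrefl)
    then show False using t by simp
  qed
  then show "asymmetric 2 G"
    unfolding asymmetric_def G_def by (intro bexI[of _ 1] bexI[of _ 2]) auto
  have "((\<lambda>z. (1 - G 1 z) + (1 - G 2 z) - (1 - G 1 z) * (1 - G 2 z)) has_integral
      p + p - (t1 * q2 + t1 * q2 * (ln (t2 / q2) - ln (t1 / q1)) + (t1 * q2 - t1 * t2))) {0..1}"
    using has_integral_signal_tail[OF U1] has_integral_signal_tail[OF U2] mean1 mean2
      has_integral_product_of_pareto_tails[of t1 t2 q1 q2] t tq s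
    by (intro has_integral_diff has_integral_add) (auto simp: G_def)
  then have *: "((\<lambda>z. 1 - G 1 z * G 2 z) has_integral
      p + p - (t1 * q2 + t1 * q2 * (ln (t2 / q2) - ln (t1 / q1)) + (t1 * q2 - t1 * t2))) {0..1}"
    by (rule has_integral_eq[rotated]) (simp add: algebra_simps)
  have "unit_cdf (G i)" for i using U1 U2 by (simp add: G_def)
  from has_integral_unique[OF has_integral_expected_max[of G, OF this] *]
  have max: "(LINT x|(\<Pi>\<^sub>M i\<in>{1..2}. interval_measure (G i)). max (x 1) (x 2))
      = p + p - (t1 * q2 + t1 * q2 * (ln (t2 / q2) - ln (t1 / q1)) + (t1 * q2 - t1 * t2))" .
  have "ln (t2 / q2) - ln (t1 / q1) = p / t1 - p / t2"
    using ln t tq by (simp add: ln_div)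
  then have "buyers_surplus 2 G = p + p - (t1 * q2 + t1 * q2 * (p / t1 - p / t2) + (t1 * q2 - t1 * t2))
      - (1 - (1 - t1) * (1 - t2))"
    using buyers_surplus_truncated_pareto[of T Q, OF TQ] max unfolding G_eq
    by (simp add: T_def)
  also have "t1 * q2 * (p / t1 - p / t2) = q2 * (p - p * t1 / t2)"
    using t by (simp add: field_simps)
  finally show "buyers_surplus 2 G = 2 * p - t1 - t2 + 2 * t1 * t2 - q2 * (2 * t1 + p - p * t1 / t2)"
    by (simp add: algebra_simps)
qed

subsection \<open>The optimal symmetric structure\<close>

text \<open>Below \<open>q0\<close> the objective is \<open>2 * f s\<close>, and \<open>foc\<close>
  says \<open>f' t0 = 0\<close>. On the left, concavity of \<open>f\<close> up to
  \<open>q0 / 2\<close> (hence \<open>2 * t0 \<le> q0\<close>) gives \<open>f' \<ge> 0\<close>. On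
  the right, \<open>f'\<close> is convex and so lies below its chord from 0 at \<open>t0\<close> to
  \<open>q0 - 1 < 0\<close> at \<open>q0\<close>. Beyond \<open>q0\<close> the objective is at most
  0.\<close>

lemma tail_weight_le:
  assumes t0: "0 < t0" "2 * t0 \<le> q0" and q0: "q0 < 1"
    and foc: "2 * t0 + q0 * ln (q0 / t0) = q0 + 1" and s: "0 \<le> s" "s \<le> 1"
  shows "tail_weight q0 s - 2 * s + s\<^sup>2 \<le> 2 * (t0 * (q0 - t0))"
proof -
  define f where "f s = s\<^sup>2 - s + s * (q0 * (ln q0 - ln s))" for s
  define f' where "f' s = 2 * s - 1 - q0 + q0 * (ln q0 - ln s)" for s
  have foc': "q0 * (ln q0 - ln t0) = q0 + 1 - 2 * t0" using foc t0 by (simp add: ln_div)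
  have deriv: "(f has_real_derivative f' u) (at u)" if "0 < u" for u
    unfolding f_def f'_def using that
    by (auto intro!: derivative_eq_intros simp: field_simps)
  have f_t0: "f t0 = t0 * (q0 - t0)"
    unfolding f_def foc' by (simp add: power2_eq_square algebra_simps)
  have nonneg: "0 \<le> t0 * (q0 - t0)" using t0 by simp
  have f_le: "f s \<le> t0 * (q0 - t0)" if s: "0 < s" "s \<le> q0"
  proof (cases "s \<le> t0")
    case True
    have "f s \<le> f t0"
    proof (rule DERIV_nonneg_imp_nondecreasing[OF True])
      fix u assume u: "s \<le> u" "u \<le> t0"
      then have u0: "0 < u" using s by simp
      have "ln u - ln t0 \<le> u / t0 - 1"
        using ln_le_minus_one[of "u / t0"] u0 t0 by (simp add: ln_div)
      then have "q0 * (1 - u / t0) \<le> q0 * (ln t0 - ln u)"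
        using t0 by (intro mult_left_mono) auto
      moreover have "q0 * (ln q0 - ln u) = q0 * (ln q0 - ln t0) + q0 * (ln t0 - ln u)"
        by (simp add: algebra_simps)
      moreover have "2 * (u - t0) + q0 * (1 - u / t0) = (t0 - u) * (q0 - 2 * t0) / t0"
        using t0 by (simp add: field_simps)
      moreover have "0 \<le> (t0 - u) * (q0 - 2 * t0) / t0" using u t0 by simp
      moreover have "0 \<le> 2 * u - 1 - q0 + c"
        if "a \<le> b" "c = q0 + 1 - 2 * t0 + b" "2 * (u - t0) + a = d" "0 \<le> d" for a b c d
        using that by argo
      ultimately have "0 \<le> f' u" unfolding f'_def foc' by blast
      then show "\<exists>y. (f has_real_derivative y) (at u) \<and> 0 \<le> y" using deriv[OF u0] by blast
    qed
    then show ?thesis using f_t0 by simp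
  next
    case False
    have "f s \<le> f t0"
    proof (rule DERIV_nonpos_imp_nonincreasing[of t0 s f])
      fix u assume u: "t0 \<le> u" "u \<le> s"
      then have u0: "0 < u" using t0 by simp
      \<comment> \<open>\<open>l\<close> is the position of \<open>u\<close> between
        \<open>t0\<close> and \<open>q0\<close>; concavity of \<open>ln\<close> at \<open>u\<close>,
        via tangents, gives the chord bound.\<close>
      define l where "l = (u - t0) / (q0 - t0)"
      have l: "0 \<le> l" "l \<le> 1" using u t0 s by (auto simp: l_def)
      have u_eq: "u = (1 - l) * t0 + l * q0"
      proof -
        have "l * (q0 - t0) = u - t0" using t0 by (simp add: l_def)
        then show ?thesis by (simp add: algebra_simps)
      qed
      have "ln t0 \<le> ln u + (t0 / u - 1)" "ln q0 \<le> ln u + (q0 / u - 1)"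
        using ln_le_minus_one[of "t0 / u"] ln_le_minus_one[of "q0 / u"] u0 t0 by (simp_all add: ln_div)
      then have "(1 - l) * ln t0 + l * ln q0 \<le> (1 - l) * (ln u + (t0 / u - 1)) + l * (ln u + (q0 / u - 1))"
        using l by (intro add_mono mult_left_mono) auto
      also have "\<dots> = ln u + (((1 - l) * t0 + l * q0) / u - 1)"
        by (simp add: algebra_simps add_divide_distrib diff_divide_distrib)
      also have "\<dots> = ln u" unfolding u_eq[symmetric] using u0 by simp
      finally have "ln q0 - ln u \<le> (1 - l) * (ln q0 - ln t0)" by (simp add: algebra_simps)
      then have "q0 * (ln q0 - ln u) \<le> q0 * ((1 - l) * (ln q0 - ln t0))"
        using t0 by (intro mult_left_mono) auto
      also have "\<dots> = (1 - l) * (q0 + 1 - 2 * t0)" unfolding foc'[symmetric] by simp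
      finally have "f' u \<le> 2 * u - 1 - q0 + (1 - l) * (q0 + 1 - 2 * t0)" unfolding f'_def by simp
      also have "\<dots> = l * (q0 - 1)" unfolding u_eq by (simp add: algebra_simps)
      also have "\<dots> \<le> 0" using l q0 by (simp add: mult_le_0_iff)
      finally have "f' u \<le> 0" .
      then show "\<exists>y. (f has_real_derivative y) (at u) \<and> y \<le> 0" using deriv[OF u0] by blast
    qed (use False in simp)
    then show ?thesis using f_t0 by simp
  qed
  consider "s = 0" | "0 < s" "s < q0" | "q0 \<le> s" using s by linarith
  then show ?thesis
  proof cases
    case 1
    then show ?thesis using nonneg t0 by (simp add: tail_weight_def)
  next
    case 2
    then have "tail_weight q0 s - 2 * s + s\<^sup>2 = 2 * f s"
      using t0 by (simp add: tail_weight_def f_def ln_div algebra_simps)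
    then show ?thesis using f_le 2 by simp
  next
    case 3
    have "(1 - s)\<^sup>2 \<le> (1 - q0)\<^sup>2" using 3 s t0 by (intro power_mono) auto
    moreover have "q0 * q0 \<le> 1 * q0" using q0 t0 by (intro mult_right_mono) auto
    ultimately have "q0\<^sup>2 - 2 * s + s\<^sup>2 \<le> 0" by (simp add: power2_eq_square algebra_simps)
    then show ?thesis using 3 nonneg by (simp add: tail_weight_def)
  qed
qed

lemma theta_b_props: "1 / 2 < theta_b" "theta_b < 1" "ln (1 - theta_b) = - 2 * theta_b"
proof -
  have th: "0 < theta_b \<and> theta_b < 1 \<and> 2 * theta_b + ln (1 - theta_b) = 0"
    unfolding theta_b_def by (rule theI'[OF theta_b_ex1])
  then show "theta_b < 1" "ln (1 - theta_b) = - 2 * theta_b" by auto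
  show "1 / 2 < theta_b"
  proof (rule ccontr)
    assume "\<not> 1 / 2 < theta_b"
    then consider "theta_b < 1 / 2" | "theta_b = 1 / 2" by linarith
    then show False
    proof cases
      case 1
      then have "- theta_b - 2 * theta_b\<^sup>2 \<le> ln (1 - theta_b)"
        using th by (intro ln_one_minus_pos_lower_bound) auto
      moreover have "theta_b * (2 * theta_b) < theta_b * 1"
        using 1 th by (intro mult_strict_left_mono) auto
      ultimately show False using th by (simp add: power2_eq_square)
    next
      case 2
      have "ln (1 - theta_b) = - 1" using th 2 by linarith
      then have "ln (1 / 2 :: real) = - 1" unfolding 2 by simp
      then show False using ln_2_less_1 by (simp add: ln_div)
    qed
  qed
qed

text \<open>\<open>L\<close> is \<open>ln (q / t)\<close> for the optimal symmetric truncated Pareto distribution; the equation is the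
  first-order condition.\<close>

lemma exists_optimal_log_ratio:
  assumes p: "0 < p" "p < r_b"
  obtains L where "1 < L" "p * (2 + exp L * (L - 1)) = 1 + L" "p * exp L < 1 + L"
proof -
  note th = theta_b_props
  \<comment> \<open>\<open>l\<close> is the log ratio of the optimal distribution at mean
    \<open>r_b\<close>, where the atom at 0 vanishes: \<open>exp2\<close> below is the first-order
    condition with \<open>q = 1\<close>.\<close>
  define l where "l = 2 * theta_b"
  have l: "1 < l" "l < 2" using th by (auto simp: l_def)
  have exp_l: "exp l * (1 - theta_b) = 1"
  proof -
    have "1 - theta_b = exp (- l)" using th by (metis exp_ln_iff l_def diff_gt_0_iff_gt mult_minus_left)
    then show ?thesis by (simp add: exp_minus)
  qed
  define D where "D L = p * (2 + exp L * (L - 1)) - (1 + L)" for L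
  have "p < (1 - theta_b) * (1 + l)" using p th unfolding r_b_def l_def by simp
  then have "exp l * p < exp l * ((1 - theta_b) * (1 + l))" by simp
  also have "\<dots> = 1 + l" using exp_l by (simp add: mult.assoc[symmetric])
  finally have pl: "p * exp l < 1 + l" by (simp add: mult.commute)
  have exp2: "exp l * (2 - l) = 2"
    using exp_l by (simp add: l_def algebra_simps)
  then have "2 + exp l * (l - 1) = exp l" by (simp add: algebra_simps)
  then have Dl: "D l < 0" using pl by (simp add: D_def)
  \<comment> \<open>A crude upper end: with \<open>exp r \<ge> 1 + r\<close>, the factor
    \<open>p * (r - 1) = p + 1\<close> already makes \<open>D r\<close> nonnegative.\<close>
  define r where "r = 2 + 1 / p"
  have r: "2 < r" using p by (simp add: r_def)
  have Dr: "0 \<le> D r"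
  proof -
    have "(1 + r) * (r - 1) \<le> exp r * (r - 1)" using r by (intro mult_right_mono) auto
    then have le: "(1 + r) * (r - 1) \<le> 2 + exp r * (r - 1)" by simp
    have "(1 + r) * 1 \<le> (1 + r) * (p + 1)" using r p by (intro mult_left_mono) auto
    also have "\<dots> = p * ((1 + r) * (r - 1))" using p by (simp add: r_def field_simps)
    also have "\<dots> \<le> p * (2 + exp r * (r - 1))" using p le by (intro mult_left_mono) auto
    finally show ?thesis unfolding D_def by simp
  qed
  have "continuous_on {l..r} D" unfolding D_def by (intro continuous_intros)
  then obtain L where L: "l \<le> L" "L \<le> r" "D L = 0"
    using IVT'[of D l 0 r] Dl Dr l r by auto
  have "l < L" using L Dl by (cases "l = L") auto
  define h where "h = L - l"
  have h: "0 < h" "L = l + h" using \<open>l < L\<close> by (auto simp: h_def)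
  \<comment> \<open>\<open>exp L * (2 - L)\<close> decreases for \<open>L > 1\<close> and equals 2
    at \<open>l\<close>. Inserted into \<open>D L = 0\<close>, this gives
    \<open>p * exp L < 1 + L\<close>, that is, a positive atom at 0.\<close>
  have "exp L * (2 - L) < 2"
  proof (cases "L < 2")
    case False
    then have "exp L * (2 - L) \<le> 0" by (simp add: mult_le_0_iff)
    then show ?thesis by simp
  next
    case True
    have "(2 - l) * h < 1 * h" using l h by (intro mult_strict_right_mono) auto
    then have "2 - L < (2 - l) * (1 - h)" using h by (simp add: algebra_simps)
    also have "\<dots> \<le> (2 - l) * exp (- h)"
      using exp_ge_add_one_self[of "- h"] l by (intro mult_left_mono) auto
    finally have "exp L * (2 - L) < exp L * ((2 - l) * exp (- h))" by simp
    also have "\<dots> = exp l * (2 - l)" using h by (simp add: exp_add exp_minus field_simps)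
    finally show ?thesis using exp2 by simp
  qed
  then have "exp L < 2 + exp L * (L - 1)" by (simp add: algebra_simps)
  then have "p * exp L < p * (2 + exp L * (L - 1))" using p by simp
  then show thesis using that[of L] L l unfolding D_def by simp
qed

text \<open>At \<open>t2 = t0\<close> the surplus of the asymmetric pair does not depend on \<open>t1\<close>, by the first-order
  condition, and equals the symmetric optimum. Lowering \<open>t1\<close> below \<open>t0\<close> therefore costs nothing, and
  it makes the derivative in \<open>t2\<close> positive.\<close>

lemma exists_better_asymmetric:
  assumes p: "0 < p" "p < 1" "p < r_b"
  obtains G B where "information_structure 2 p G" "asymmetric 2 G" "B < buyers_surplus 2 G"
    "\<And>H. signal_cdf p H \<Longrightarrow> buyers_surplus 2 (\<lambda>_. H) \<le> B"
proof -
  obtain L where L: "1 < L" and D: "p * (2 + exp L * (L - 1)) = 1 + L" and q_less: "p * exp L < 1 + L"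
    using exists_optimal_log_ratio[OF p(1,3)] .
  define E where "E = exp L"
  have E: "2 \<le> E" unfolding E_def using exp_ge_add_one_self[of L] L by linarith
  \<comment> \<open>Solving the mean condition \<open>t0 * (1 + L) = p\<close> and
    \<open>ln (q0 / t0) = L\<close>.\<close>
  define t0 q0 where "t0 = p / (1 + L)" and "q0 = t0 * E"
  have t0: "0 < t0" "t0 < p" using p L by (auto simp: t0_def field_simps)
  have pt0: "p = t0 * (1 + L)" using L by (simp add: t0_def)
  have q0: "0 < q0" "q0 < 1" using t0 E L q_less by (auto simp: q0_def t0_def E_def field_simps)
  have foc: "t0 * (2 + E * (L - 1)) = 1"
  proof -
    have "(1 + L) * (t0 * (2 + E * (L - 1))) = (1 + L) * 1"
      using D unfolding pt0 E_def by (simp add: mult.commute mult.left_commute)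
    then show ?thesis using L by (simp only: mult_cancel_left) simp
  qed
  have "q0 / t0 = exp L" using t0 by (simp add: q0_def E_def)
  then have "ln (q0 / t0) = L" by simp
  then have foc': "2 * t0 + q0 * ln (q0 / t0) = q0 + 1"
    using foc by (simp add: q0_def algebra_simps)
  define B where "B = 2 * (1 - q0) * p + 2 * (t0 * (q0 - t0))"
  have t0q0: "2 * t0 \<le> q0" using E t0 by (simp add: q0_def)
  have upper: "buyers_surplus 2 (\<lambda>_. H) \<le> B" if "signal_cdf p H" for H
  proof -
    have H: "unit_cdf H" "(LINT x|interval_measure H. x) = p" using that by (auto simp: signal_cdf_def)
    have "buyers_surplus 2 (\<lambda>_. H) \<le> 2 * (1 - q0) * (LINT x|interval_measure H. x) + 2 * (t0 * (q0 - t0))"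
      using t0 t0q0 q0 tail_weight_le[OF t0(1) t0q0 q0(2) foc'] by (intro symmetric_surplus_le[OF H(1) q0]) auto
    then show ?thesis unfolding H(2) B_def .
  qed
  \<comment> \<open>\<open>Q u\<close> is the probability of a positive signal that keeps the mean
    at \<open>p\<close> when the mass at 1 is \<open>u\<close>. Continuity keeps
    \<open>Q < 1\<close> for masses near \<open>t0\<close> on either side.\<close>
  define Q where "Q u = u * exp (p / u - 1)" for u
  have Q_t0: "Q t0 = q0" using pt0 t0 by (simp add: Q_def q0_def E_def)
  have Q_cont: "isCont Q t0" unfolding Q_def using t0 by (intro continuous_intros) auto
  have "\<forall>\<^sub>F u in at t0. Q u < 1"
    using order_tendstoD(2)[OF Q_cont[unfolded isCont_def], of 1] q0 Q_t0 by simp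
  then have Q_left: "\<forall>\<^sub>F u in at_left t0. Q u < 1" and Q_right: "\<forall>\<^sub>F u in at_right t0. Q u < 1"
    by (auto simp: eventually_at_split)
  have "\<forall>\<^sub>F u in at_left t0. Q u < 1 \<and> u \<in> {0<..<t0}"
    using Q_left eventually_at_left_real[OF t0(1)] by (rule eventually_conj)
  then obtain t1 where t1: "Q t1 < 1" "0 < t1" "t1 < t0"
    using eventually_happens'[OF trivial_limit_at_left_real] by force
  define g where "g u = 2 * p - t1 - u + 2 * t1 * u - Q u * (2 * t1 + p - p * t1 / u)" for u
  have g_t0: "g t0 = B"
  proof -
    have "g t0 = 2 * p - t1 - t0 + 2 * t1 * t0 - q0 * (2 * t1 + p - (1 + L) * t1)"
      unfolding g_def Q_t0 using t0 by (simp add: pt0)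
    also have "\<dots> = 2 * p - t0 - p * q0 + t1 * (t0 * (2 + E * (L - 1)) - 1)"
      by (simp add: q0_def algebra_simps)
    also have "\<dots> = 2 * p - t0 - p * q0" using foc by simp
    also have "\<dots> = B + t0 * (t0 * (2 + E * (L - 1)) - 1)"
    proof -
      have "t0 * (t0 * (2 + E * (L - 1))) = 2 * (t0 * t0) + q0 * (p - 2 * t0)"
        unfolding q0_def by (subst pt0) (simp add: algebra_simps)
      then show ?thesis unfolding B_def by (simp add: algebra_simps)
    qed
    finally show ?thesis using foc by simp
  qed
  have Q_deriv: "(Q has_real_derivative - (E * L)) (at t0)"
  proof -
    have "(Q has_real_derivative exp (p / t0 - 1) + t0 * (exp (p / t0 - 1) * - (p / (t0 * t0)))) (at t0)"
      unfolding Q_def using t0 by (auto intro!: derivative_eq_intros)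
    moreover have "p / t0 - 1 = L" "p / (t0 * t0) = (1 + L) / t0" using pt0 t0 by auto
    moreover have "E + t0 * (E * - ((1 + L) / t0)) = - (E * L)" using t0 by (simp add: field_simps)
    ultimately show ?thesis by (simp add: E_def)
  qed
  have "(g has_real_derivative (t0 - t1) * (E * (1 + L * L) - 2)) (at t0)"
  proof -
    have "((\<lambda>u. p * t1 / u) has_real_derivative - (p * t1 / (t0 * t0))) (at t0)"
      using t0 by (auto intro!: derivative_eq_intros)
    then have "(g has_real_derivative - 1 + 2 * t1
        - (- (E * L) * (2 * t1 + p - p * t1 / t0) + Q t0 * (p * t1 / (t0 * t0)))) (at t0)"
      unfolding g_def using Q_deriv t0 by (auto intro!: derivative_eq_intros)
    moreover have "p * t1 / t0 = (1 + L) * t1" "Q t0 * (p * t1 / (t0 * t0)) = E * (1 + L) * t1"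
      unfolding Q_t0 using t0 by (auto simp: pt0 q0_def)
    ultimately have "(g has_real_derivative - 1 + 2 * t1
        - (- (E * L) * (2 * t1 + p - (1 + L) * t1) + E * (1 + L) * t1)) (at t0)"
      by simp
    \<comment> \<open>The last bracket vanishes by \<open>foc\<close>. What remains is proportional
      to \<open>t0 - t1\<close>: zero at the symmetric optimum and positive once \<open>t1\<close>
      has been lowered.\<close>
    moreover have "- 1 + 2 * t1 - (- (E * L) * (2 * t1 + p - (1 + L) * t1) + E * (1 + L) * t1)
        = (t0 - t1) * (E * (1 + L * L) - 2) + (t0 * (2 + E * (L - 1)) - 1)"
      by (subst pt0) (simp add: algebra_simps)
    ultimately show ?thesis using foc by simp
  qed
  moreover have "0 < (t0 - t1) * (E * (1 + L * L) - 2)"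
  proof -
    have "1 * 1 < L * L" using L by (intro mult_strict_mono) auto
    then have "2 * 2 < E * (1 + L * L)" using E by (intro mult_le_less_imp_less) auto
    then show ?thesis using t1 by simp
  qed
  ultimately obtain d where d: "d > 0" "\<And>h. 0 < h \<Longrightarrow> h < d \<Longrightarrow> g t0 < g (t0 + h)"
    using DERIV_pos_inc_right by blast
  have "\<forall>\<^sub>F u in at_right t0. Q u < 1 \<and> u \<in> {t0<..<min p (t0 + d)}"
    using Q_right eventually_at_right_real[of t0 "min p (t0 + d)"] t0 d(1) by (intro eventually_conj) auto
  then obtain t2 where t2: "Q t2 < 1" "t0 < t2" "t2 < p" "t2 < t0 + d"
    using eventually_happens'[OF trivial_limit_at_right_real] by force
  have g_t2: "B < g t2" using d(2)[of "t2 - t0"] t2 g_t0 by simp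
  show thesis
  proof (rule that)
    let ?G = "\<lambda>i::nat. if i = 1 then truncated_pareto t1 (Q t1) else truncated_pareto t2 (Q t2)"
    have t: "0 < t1" "t1 < t2" "t2 < p" using t1 t2 by auto
    show "information_structure 2 p ?G" "asymmetric 2 ?G"
      by (rule asymmetric_pareto_surplus[OF t Q_def Q_def t1(1) t2(1)])+
    show "B < buyers_surplus 2 ?G"
      using g_t2 unfolding asymmetric_pareto_surplus(3)[OF t Q_def Q_def t1(1) t2(1)] g_def .
    show "buyers_surplus 2 (\<lambda>_. H) \<le> B" if "signal_cdf p H" for H by (rule upper[OF that])
  qed
qed

text \<open>Improving upon a limit is expressed by a gain \<open>\<epsilon>\<close> that is the same
  for all large \<open>n\<close>. Part (i) speaks about every maximizer, so it needs neither its
  form nor its uniqueness.\<close>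

theorem proposition1:
  fixes p :: real
  assumes "0 < p" and "p < 1"
  shows "(p < r_b \<longrightarrow>
            (\<forall>G\<^sub>b. symmetric_buyer_optimal 2 p G\<^sub>b \<longrightarrow>
              (\<exists>G. information_structure 2 p G \<and> asymmetric 2 G \<and>
                   buyers_surplus 2 G > buyers_surplus 2 (\<lambda>_. G\<^sub>b)))) \<and>
         (\<forall>n\<ge>1. buyers_surplus n (\<lambda>_. degenerate_cdf p) = 0) \<and>
         (\<exists>\<epsilon>>0. \<forall>\<^sub>F n in sequentially.
            \<exists>G. information_structure n p G \<and> asymmetric n G \<and>
                buyers_surplus n G \<ge> buyers_surplus n (\<lambda>_. degenerate_cdf p) + \<epsilon>)"
proof (intro conjI impI allI)
  fix G\<^sub>b assume "p < r_b" and opt: "symmetric_buyer_optimal 2 p G\<^sub>b"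
  then obtain G B where G: "information_structure 2 p G" "asymmetric 2 G" "B < buyers_surplus 2 G"
    and B: "\<And>H. signal_cdf p H \<Longrightarrow> buyers_surplus 2 (\<lambda>_. H) \<le> B"
    using exists_better_asymmetric[OF assms] by metis
  have "signal_cdf p G\<^sub>b" using opt by (simp add: symmetric_buyer_optimal_def is_arg_max_def)
  then have "buyers_surplus 2 (\<lambda>_. G\<^sub>b) < buyers_surplus 2 G" using B G(3) by force
  then show "\<exists>G. information_structure 2 p G \<and> asymmetric 2 G \<and>
      buyers_surplus 2 G > buyers_surplus 2 (\<lambda>_. G\<^sub>b)"
    using G by blast
next
  show "buyers_surplus n (\<lambda>_. degenerate_cdf p) = 0" for n
    by (rule buyers_surplus_degenerate[OF assms])
next
  let ?e = "p * (1 - p) / (2 * (2 + p))"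
  \<comment> \<open>Asymmetry needs a second buyer, so the gain is claimed from \<open>n = 2\<close>
    on.\<close>
  have "\<exists>G. information_structure n p G \<and> asymmetric n G \<and>
      buyers_surplus n G \<ge> buyers_surplus n (\<lambda>_. degenerate_cdf p) + ?e" if n: "2 \<le> n" for n
  proof (intro exI conjI)
    let ?G = "\<lambda>i::nat. if i = 1 then three_point_cdf p else degenerate_cdf p"
    show "information_structure n p ?G"
      using signal_cdf_three_point[OF assms] signal_cdf_degenerate[OF assms]
      by (simp add: information_structure_def)
    have "three_point_cdf p 0 \<noteq> degenerate_cdf p 0"
      using three_point_params[OF assms] assms by (simp add: three_point_cdf_def degenerate_cdf_def)
    then have "?G 1 \<noteq> ?G 2" by auto
    then show "asymmetric n ?G"
      unfolding asymmetric_def using n by (intro bexI[of _ 1] bexI[of _ 2]) auto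
    show "buyers_surplus n ?G \<ge> buyers_surplus n (\<lambda>_. degenerate_cdf p) + ?e"
      using buyers_surplus_three_point[OF assms, of n] buyers_surplus_degenerate[OF assms, of n] n by simp
  qed
  then have "\<forall>\<^sub>F n in sequentially. \<exists>G. information_structure n p G \<and> asymmetric n G \<and>
      buyers_surplus n G \<ge> buyers_surplus n (\<lambda>_. degenerate_cdf p) + ?e"
    using eventually_sequentially by blast
  moreover have "?e > 0" using assms by simp
  ultimately show "\<exists>\<epsilon>>0. \<forall>\<^sub>F n in sequentially. \<exists>G. information_structure n p G \<and> asymmetric n G \<and>
      buyers_surplus n G \<ge> buyers_surplus n (\<lambda>_. degenerate_cdf p) + \<epsilon>"
    by blast
qed

end
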